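(* Let $H$ be a weak bialgebra over the field $k$. Then $H$ is a weak Hopf algebra if and only if the map $$\beta_0\colon H\otimes H\to H\otimes H,\qquad g\otimes h\mapsto g_{(1)}\otimes g_{(2)}h$$ induces an isomorphism $$\beta\colon H\otimes_{H_s}H\to\Delta(1)(H\otimes H).$$
   Context: $k$ is a field; algebras (unital, associative), coalgebras, $\otimes$ are over $k$; Sweedler notation $\Delta(h)=h_{(1)}\otimes h_{(2)}$, and $1_{(1)}\otimes 1_{(2)}=\Delta(1)$. Weak bialgebra: an algebra and coalgebra $H$ with $\Delta(gh)=\Delta(g)\Delta(h)$ and, for all $f,g,h\in H$: $\epsilon(fgh)=\epsilon(fg_{(1)})\epsilon(g_{(2)}h)=\epsilon(fg_{(2)})\epsilon(g_{(1)}h)$, and $1_{(1)}\otimes1_{(2)}\otimes1_{(3)}=(\Delta(1)\otimes1)(1\otimes\Delta(1))=(1\otimes\Delta(1))(\Delta(1)\otimes1)$. (Neither $\Delta(1)=1\otimes1$ nor multiplicativity of $\epsilon$ is required.) Counital maps: $\epsilon_s(h)=1_{(1)}\epsilon(h1_{(2)})$, $\epsilon_t(h)=\epsilon(1_{(1)}h)1_{(2)}$. $H_s=\epsilon_s(H)$ is a subalgebra of $H$, the source counital subalgebra; $H\otimes_{H_s}H$ is formed using right and left multiplication by elements of $H_s$ in $H$. Weak Hopf algebra: a weak bialgebra $H$ for which there exists a $k$-linear map $S\colon H\to H$ (antipode) with $S(h_{(1)})h_{(2)}=\epsilon_s(h)$, $h_{(1)}S(h_{(2)})=\epsilon_t(h)$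 and $S(h_{(1)})h_{(2)}S(h_{(3)})=S(h)$ for all $h\in H$. *)

theory Defs
  imports "HOL-Library.Poly_Mapping" HOL.Vector_Spaces
begin

section \<open>Free vector spaces and their quotients\<close>

text \<open>\<open>'x \<Rightarrow>\<^sub>0 'k\<close> is the free \<open>'k\<close>-vector space on \<open>'x\<close>, with basis the elements
  \<open>Poly_Mapping.single x 1\<close>.\<close>

definition fscale :: "'k::field \<Rightarrow> ('x \<Rightarrow>\<^sub>0 'k) \<Rightarrow> ('x \<Rightarrow>\<^sub>0 'k)" where
  "fscale c u = Poly_Mapping.map ((*) c) u"

lemma lookup_fscale [simp]:
  "Poly_Mapping.lookup (fscale c u) x = c * Poly_Mapping.lookup u x"
  by (simp add: fscale_def Poly_Mapping.map.rep_eq when_def)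

interpretation free: vector_space "fscale :: 'k::field \<Rightarrow> ('x \<Rightarrow>\<^sub>0 'k) \<Rightarrow> ('x \<Rightarrow>\<^sub>0 'k)"
  by unfold_locales (auto intro!: poly_mapping_eqI simp: Poly_Mapping.lookup_add algebra_simps)

definition basis :: "'x \<Rightarrow> ('x \<Rightarrow>\<^sub>0 'k::field)" where
  "basis x = Poly_Mapping.single x 1"

definition lin_ext :: "('k::field \<Rightarrow> 'v \<Rightarrow> 'v::ab_group_add) \<Rightarrow> ('x \<Rightarrow> 'v) \<Rightarrow> ('x \<Rightarrow>\<^sub>0 'k) \<Rightarrow> 'v" where
  "lin_ext sc f u = (\<Sum>x\<in>Poly_Mapping.keys u. sc (Poly_Mapping.lookup u x) (f x))"

text \<open>Elements of the quotient of the free space by a subspace \<open>R\<close> are cosets of \<open>R\<close>.\<close>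

definition qcls :: "('x \<Rightarrow>\<^sub>0 'k::field) set \<Rightarrow> ('x \<Rightarrow>\<^sub>0 'k) \<Rightarrow> ('x \<Rightarrow>\<^sub>0 'k) set" where
  "qcls R u = {u + r | r. r \<in> R}"

definition quot :: "('x \<Rightarrow>\<^sub>0 'k::field) set \<Rightarrow> ('x \<Rightarrow>\<^sub>0 'k) set set" where
  "quot R = range (qcls R)"

definition rep :: "('x \<Rightarrow>\<^sub>0 'k::field) set \<Rightarrow> ('x \<Rightarrow>\<^sub>0 'k)" where
  "rep X = (SOME u. u \<in> X)"

definition qadd :: "('x \<Rightarrow>\<^sub>0 'k::field) set \<Rightarrow> ('x \<Rightarrow>\<^sub>0 'k) set \<Rightarrow> ('x \<Rightarrow>\<^sub>0 'k) set \<Rightarrow> ('x \<Rightarrow>\<^sub>0 'k) set" where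
  "qadd R X Y = qcls R (rep X + rep Y)"

definition qscale :: "('x \<Rightarrow>\<^sub>0 'k::field) set \<Rightarrow> 'k \<Rightarrow> ('x \<Rightarrow>\<^sub>0 'k) set \<Rightarrow> ('x \<Rightarrow>\<^sub>0 'k) set" where
  "qscale R c X = qcls R (fscale c (rep X))"

definition quot_linear ::
    "('x \<Rightarrow>\<^sub>0 'k::field) set \<Rightarrow> ('y \<Rightarrow>\<^sub>0 'k) set \<Rightarrow> (('x \<Rightarrow>\<^sub>0 'k) set \<Rightarrow> ('y \<Rightarrow>\<^sub>0 'k) set) \<Rightarrow> bool" where
  "quot_linear R R' F \<longleftrightarrow>
     (\<forall>X\<in>quot R. \<forall>Y\<in>quot R. F (qadd R X Y) = qadd R' (F X) (F Y)) \<and>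
     (\<forall>c. \<forall>X\<in>quot R. F (qscale R c X) = qscale R' c (F X))"

text \<open>The linear map on a quotient of the free space on \<open>'x\<close> which is given on generators by \<open>f\<close>,
  with values in a vector space (\<open>vlift\<close>) or in another quotient of a free space (\<open>qlift\<close>).
  Both are computed on a chosen representative; that the choice is irrelevant as soon as \<open>f\<close>
  respects the relations is shown in \<open>vlift_qcls\<close> and \<open>qlift_qcls\<close> below. Applied to a coset
  \<open>\<Delta>(h)\<close> they express Sweedler notation.\<close>

definition vlift :: "('k::field \<Rightarrow> 'v \<Rightarrow> 'v::ab_group_add) \<Rightarrow> ('x \<Rightarrow> 'v) \<Rightarrow> ('x \<Rightarrow>\<^sub>0 'k) set \<Rightarrow> 'v" where
  "vlift sc f X = lin_ext sc f (rep X)"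

definition qlift ::
    "('y \<Rightarrow>\<^sub>0 'k::field) set \<Rightarrow> ('x \<Rightarrow> ('y \<Rightarrow>\<^sub>0 'k) set) \<Rightarrow> ('x \<Rightarrow>\<^sub>0 'k) set \<Rightarrow> ('y \<Rightarrow>\<^sub>0 'k) set" where
  "qlift R' f X = qcls R' (lin_ext fscale (\<lambda>x. rep (f x)) (rep X))"

lemma linear_lin_ext:
  fixes sc :: "'k::field \<Rightarrow> 'v \<Rightarrow> 'v::ab_group_add" and f :: "'x \<Rightarrow> 'v"
  assumes "vector_space sc"
  shows "Vector_Spaces.linear fscale sc (lin_ext sc f)"
proof -
  interpret V: vector_space sc by fact
  have ext: "lin_ext sc f u = (\<Sum>x\<in>A. sc (Poly_Mapping.lookup u x) (f x))"
    if "finite A" "Poly_Mapping.keys u \<subseteq> A" for u :: "'x \<Rightarrow>\<^sub>0 'k" and A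
    unfolding lin_ext_def by (rule sum.mono_neutral_left) (use that in \<open>auto simp: in_keys_iff\<close>)
  show ?thesis
  proof unfold_locales
    fix u v :: "'x \<Rightarrow>\<^sub>0 'k"
    let ?A = "Poly_Mapping.keys u \<union> Poly_Mapping.keys v"
    have "Poly_Mapping.keys (u + v) \<subseteq> ?A" by (rule Poly_Mapping.keys_add)
    then show "lin_ext sc f (u + v) = lin_ext sc f u + lin_ext sc f v"
      by (simp add: ext[of ?A] Poly_Mapping.lookup_add V.scale_left_distrib sum.distrib)
  next
    fix c :: 'k and u :: "'x \<Rightarrow>\<^sub>0 'k"
    have "Poly_Mapping.keys (fscale c u) \<subseteq> Poly_Mapping.keys u" by (auto simp: in_keys_iff)
    then show "lin_ext sc f (fscale c u) = sc c (lin_ext sc f u)"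
      by (simp add: ext[of "Poly_Mapping.keys u"] V.scale_sum_right)
  qed
qed

lemma rep_qcls:
  assumes "free.subspace R"
  obtains r where "r \<in> R" "rep (qcls R u) = u + r"
proof -
  have "u + 0 \<in> qcls R u"
    using free.subspace_0[OF assms] by (auto simp: qcls_def)
  then have "rep (qcls R u) \<in> qcls R u"
    unfolding rep_def by (rule someI)
  then show thesis
    using that by (auto simp: qcls_def)
qed

lemma qcls_eq_iff:
  assumes "free.subspace R"
  shows "qcls R u = qcls R v \<longleftrightarrow> u - v \<in> R"
proof
  assume "qcls R u = qcls R v"
  moreover have "u + 0 \<in> qcls R u"
    using free.subspace_0[OF assms] by (auto simp: qcls_def)
  ultimately show "u - v \<in> R" by (auto simp: qcls_def)
next
  assume uv: "u - v \<in> R"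
  have "\<exists>r'. u + r = v + r' \<and> r' \<in> R" if "r \<in> R" for r
    using free.subspace_add[OF assms uv that] by (intro exI[of _ "u - v + r"]) auto
  moreover have "\<exists>r'. v + r = u + r' \<and> r' \<in> R" if "r \<in> R" for r
    using free.subspace_diff[OF assms that uv] by (intro exI[of _ "r - (u - v)"]) auto
  ultimately show "qcls R u = qcls R v" by (auto simp: qcls_def)
qed

lemma vlift_qcls:
  assumes "vector_space sc" and "\<forall>r\<in>G. lin_ext sc f r = 0"
  shows "vlift sc f (qcls (free.span G) u) = lin_ext sc f u"
proof -
  interpret V: vector_space sc by fact
  interpret L: Vector_Spaces.linear fscale sc "lin_ext sc f"
    using assms(1) by (rule linear_lin_ext)
  obtain r where r: "r \<in> free.span G" "rep (qcls (free.span G) u) = u + r"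
    by (rule rep_qcls[OF free.subspace_span])
  have "lin_ext sc f r = 0"
    using r(1) assms(2) L.eq_0_on_span by blast
  then show ?thesis
    by (simp add: vlift_def r(2) L.add)
qed

lemma qlift_qcls:
  assumes R': "free.subspace R'" and G: "\<forall>r\<in>G. lin_ext fscale (\<lambda>x. rep (f x)) r \<in> R'"
  shows "qlift R' f (qcls (free.span G) u) = qcls R' (lin_ext fscale (\<lambda>x. rep (f x)) u)"
proof -
  let ?L = "lin_ext fscale (\<lambda>x. rep (f x))"
  interpret L: Vector_Spaces.linear fscale fscale ?L
    by (rule linear_lin_ext) unfold_locales
  obtain r where r: "r \<in> free.span G" "rep (qcls (free.span G) u) = u + r"
    by (rule rep_qcls[OF free.subspace_span])
  have "free.subspace (?L -` R')"
    using L.subspace_vimage[OF R'] .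
  then have "?L r \<in> R'"
    using r(1) G free.span_minimal[of G "?L -` R'"] by auto
  then show ?thesis
    by (simp add: qlift_def r(2) L.add qcls_eq_iff[OF R'])
qed

section \<open>Tensor products\<close>

text \<open>For a vector space \<open>V\<close> (the type \<open>'v\<close> with the scalar multiplication \<open>sc\<close>), the tensor products
  \<open>V \<otimes> V\<close> and \<open>V \<otimes> V \<otimes> V\<close> are the quotients of the free vector spaces on \<open>V \<times> V\<close> and
  \<open>V \<times> V \<times> V\<close> by the bilinear, respectively trilinear, relations.\<close>

definition rel2 :: "('k::field \<Rightarrow> 'v \<Rightarrow> 'v::ab_group_add) \<Rightarrow> ('v \<times> 'v \<Rightarrow>\<^sub>0 'k) set" where
  "rel2 sc =
     {basis (a + a', b) - basis (a, b) - basis (a', b) | a a' b. True} \<union>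
     {basis (a, b + b') - basis (a, b) - basis (a, b') | a b b'. True} \<union>
     {basis (sc c a, b) - fscale c (basis (a, b)) | c a b. True} \<union>
     {basis (a, sc c b) - fscale c (basis (a, b)) | c a b. True}"

definition rel3 :: "('k::field \<Rightarrow> 'v \<Rightarrow> 'v::ab_group_add) \<Rightarrow> ('v \<times> 'v \<times> 'v \<Rightarrow>\<^sub>0 'k) set" where
  "rel3 sc =
     {basis (a + a', b, d) - basis (a, b, d) - basis (a', b, d) | a a' b d. True} \<union>
     {basis (a, b + b', d) - basis (a, b, d) - basis (a, b', d) | a b b' d. True} \<union>
     {basis (a, b, d + d') - basis (a, b, d) - basis (a, b, d') | a b d d'. True} \<union>
     {basis (sc c a, b, d) - fscale c (basis (a, b, d)) | c a b d. True} \<union>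
     {basis (a, sc c b, d) - fscale c (basis (a, b, d)) | c a b d. True} \<union>
     {basis (a, b, sc c d) - fscale c (basis (a, b, d)) | c a b d. True}"

definition ker2 :: "('k::field \<Rightarrow> 'v \<Rightarrow> 'v::ab_group_add) \<Rightarrow> ('v \<times> 'v \<Rightarrow>\<^sub>0 'k) set" where
  "ker2 sc = free.span (rel2 sc)"

definition ker3 :: "('k::field \<Rightarrow> 'v \<Rightarrow> 'v::ab_group_add) \<Rightarrow> ('v \<times> 'v \<times> 'v \<Rightarrow>\<^sub>0 'k) set" where
  "ker3 sc = free.span (rel3 sc)"

abbreviation tensor2 :: "('k::field \<Rightarrow> 'v \<Rightarrow> 'v::ab_group_add) \<Rightarrow> ('v \<times> 'v \<Rightarrow>\<^sub>0 'k) set set" where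
  "tensor2 sc \<equiv> quot (ker2 sc)"

definition tens2 :: "('k::field \<Rightarrow> 'v \<Rightarrow> 'v::ab_group_add) \<Rightarrow> 'v \<Rightarrow> 'v \<Rightarrow> ('v \<times> 'v \<Rightarrow>\<^sub>0 'k) set" where
  "tens2 sc a b = qcls (ker2 sc) (basis (a, b))"

definition tens3 :: "('k::field \<Rightarrow> 'v \<Rightarrow> 'v::ab_group_add) \<Rightarrow> 'v \<Rightarrow> 'v \<Rightarrow> 'v \<Rightarrow> ('v \<times> 'v \<times> 'v \<Rightarrow>\<^sub>0 'k) set" where
  "tens3 sc a b d = qcls (ker3 sc) (basis (a, b, d))"

section \<open>Coalgebras and algebras\<close>

locale coalgebra = vector_space scale
  for scale :: "'k::field \<Rightarrow> 'h::ab_group_add \<Rightarrow> 'h" +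
  fixes \<Delta> :: "'h \<Rightarrow> ('h \<times> 'h \<Rightarrow>\<^sub>0 'k) set"
    and \<epsilon> :: "'h \<Rightarrow> 'k"
  assumes comult_closed: "\<Delta> h \<in> tensor2 scale"
    and comult_add: "\<Delta> (g + h) = qadd (ker2 scale) (\<Delta> g) (\<Delta> h)"
    and comult_scale: "\<Delta> (scale c h) = qscale (ker2 scale) c (\<Delta> h)"
    and counit_linear: "Vector_Spaces.linear scale (*) \<epsilon>"
    and coassoc:
      "qlift (ker3 scale) (\<lambda>(a, b). qlift (ker3 scale) (\<lambda>(p, q). tens3 scale p q b) (\<Delta> a)) (\<Delta> h) =
       qlift (ker3 scale) (\<lambda>(a, b). qlift (ker3 scale) (\<lambda>(p, q). tens3 scale a p q) (\<Delta> b)) (\<Delta> h)"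
    and counit_left: "vlift scale (\<lambda>(a, b). scale (\<epsilon> a) b) (\<Delta> h) = h"
    and counit_right: "vlift scale (\<lambda>(a, b). scale (\<epsilon> b) a) (\<Delta> h) = h"
begin

definition comult2 :: "'h \<Rightarrow> ('h \<times> 'h \<times> 'h \<Rightarrow>\<^sub>0 'k) set" where
  "comult2 h =
     qlift (ker3 scale) (\<lambda>(a, b). qlift (ker3 scale) (\<lambda>(p, q). tens3 scale p q b) (\<Delta> a)) (\<Delta> h)"

end

text \<open>The sort \<open>{ring, monoid_mult}\<close> is that of unital associative rings, the zero ring included
  (unlike \<open>ring_1\<close>).\<close>

locale unital_algebra = vector_space scale
  for scale :: "'k::field \<Rightarrow> 'h::{ring, monoid_mult} \<Rightarrow> 'h" +
  assumes scale_mult_left: "scale c g * h = scale c (g * h)"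
    and scale_mult_right: "g * scale c h = scale c (g * h)"
begin

definition mult2 :: "('h \<times> 'h \<Rightarrow>\<^sub>0 'k) set \<Rightarrow> ('h \<times> 'h \<Rightarrow>\<^sub>0 'k) set \<Rightarrow> ('h \<times> 'h \<Rightarrow>\<^sub>0 'k) set" where
  "mult2 X Y =
     qlift (ker2 scale) (\<lambda>(a, b). qlift (ker2 scale) (\<lambda>(a', b'). tens2 scale (a * a') (b * b')) Y) X"

definition mult3 ::
    "('h \<times> 'h \<times> 'h \<Rightarrow>\<^sub>0 'k) set \<Rightarrow> ('h \<times> 'h \<times> 'h \<Rightarrow>\<^sub>0 'k) set \<Rightarrow> ('h \<times> 'h \<times> 'h \<Rightarrow>\<^sub>0 'k) set" where
  "mult3 X Y =
     qlift (ker3 scale) (\<lambda>(a, b, d).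
       qlift (ker3 scale) (\<lambda>(a', b', d'). tens3 scale (a * a') (b * b') (d * d')) Y) X"

text \<open>\<open>tensor_one X = X \<otimes> 1\<close> and \<open>one_tensor X = 1 \<otimes> X\<close>.\<close>

definition tensor_one :: "('h \<times> 'h \<Rightarrow>\<^sub>0 'k) set \<Rightarrow> ('h \<times> 'h \<times> 'h \<Rightarrow>\<^sub>0 'k) set" where
  "tensor_one X = qlift (ker3 scale) (\<lambda>(a, b). tens3 scale a b 1) X"

definition one_tensor :: "('h \<times> 'h \<Rightarrow>\<^sub>0 'k) set \<Rightarrow> ('h \<times> 'h \<times> 'h \<Rightarrow>\<^sub>0 'k) set" where
  "one_tensor X = qlift (ker3 scale) (\<lambda>(a, b). tens3 scale 1 a b) X"

text \<open>For a subalgebra \<open>A\<close> of \<open>H\<close>, the quotient \<open>quot (ker_over A)\<close> is \<open>H \<otimes>\<^sub>A H\<close>.\<close>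

definition ker_over :: "'h set \<Rightarrow> ('h \<times> 'h \<Rightarrow>\<^sub>0 'k) set" where
  "ker_over A =
     free.span (rel2 scale \<union> {basis (g * x, h) - basis (g, x * h) | g x h. x \<in> A})"

end

section \<open>Weak bialgebras and weak Hopf algebras\<close>

locale weak_bialgebra = unital_algebra scale + coalgebra scale \<Delta> \<epsilon>
  for scale :: "'k::field \<Rightarrow> 'h::{ring, monoid_mult} \<Rightarrow> 'h"
    and \<Delta> :: "'h \<Rightarrow> ('h \<times> 'h \<Rightarrow>\<^sub>0 'k) set"
    and \<epsilon> :: "'h \<Rightarrow> 'k" +
  assumes comult_mult: "\<Delta> (g * h) = mult2 (\<Delta> g) (\<Delta> h)"
    and counit_mult_12: "\<epsilon> (f * g * h) = vlift (*) (\<lambda>(a, b). \<epsilon> (f * a) * \<epsilon> (b * h)) (\<Delta> g)"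
    and counit_mult_21: "\<epsilon> (f * g * h) = vlift (*) (\<lambda>(a, b). \<epsilon> (f * b) * \<epsilon> (a * h)) (\<Delta> g)"
    and comult_one_12: "comult2 1 = mult3 (tensor_one (\<Delta> 1)) (one_tensor (\<Delta> 1))"
    and comult_one_21: "comult2 1 = mult3 (one_tensor (\<Delta> 1)) (tensor_one (\<Delta> 1))"
begin

definition eps_s :: "'h \<Rightarrow> 'h" where
  "eps_s h = vlift scale (\<lambda>(a, b). scale (\<epsilon> (h * b)) a) (\<Delta> 1)"

definition eps_t :: "'h \<Rightarrow> 'h" where
  "eps_t h = vlift scale (\<lambda>(a, b). scale (\<epsilon> (a * h)) b) (\<Delta> 1)"

definition H_s :: "'h set" where
  "H_s = range eps_s"

definition is_antipode :: "('h \<Rightarrow> 'h) \<Rightarrow> bool" where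
  "is_antipode S \<longleftrightarrow>
     Vector_Spaces.linear scale scale S \<and>
     (\<forall>h. vlift scale (\<lambda>(a, b). S a * b) (\<Delta> h) = eps_s h) \<and>
     (\<forall>h. vlift scale (\<lambda>(a, b). a * S b) (\<Delta> h) = eps_t h) \<and>
     (\<forall>h. vlift scale (\<lambda>(a, b, d). S a * b * S d) (comult2 h) = S h)"

definition beta0 :: "('h \<times> 'h \<Rightarrow>\<^sub>0 'k) set \<Rightarrow> ('h \<times> 'h \<Rightarrow>\<^sub>0 'k) set" where
  "beta0 X =
     qlift (ker2 scale) (\<lambda>(g, h). qlift (ker2 scale) (\<lambda>(a, b). tens2 scale a (b * h)) (\<Delta> g)) X"

definition comult_one_ideal :: "('h \<times> 'h \<Rightarrow>\<^sub>0 'k) set set" where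
  "comult_one_ideal = mult2 (\<Delta> 1) ` tensor2 scale"

text \<open>The first conjunct says that \<open>\<beta>\<close>, precomposed with the projection
  \<open>H \<otimes> H \<rightarrow> H \<otimes>\<^bsub>H_s\<^esub> H\<close>, is \<open>beta0\<close>.\<close>

definition beta0_induces_iso :: bool where
  "beta0_induces_iso \<longleftrightarrow>
     (\<exists>\<beta>. (\<forall>u. \<beta> (qcls (ker_over H_s) u) = beta0 (qcls (ker2 scale) u)) \<and>
          quot_linear (ker_over H_s) (ker2 scale) \<beta> \<and>
          bij_betw \<beta> (quot (ker_over H_s)) comult_one_ideal)"

end

locale weak_hopf_algebra = weak_bialgebra scale \<Delta> \<epsilon>
  for scale :: "'k::field \<Rightarrow> 'h::{ring, monoid_mult} \<Rightarrow> 'h"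
    and \<Delta> :: "'h \<Rightarrow> ('h \<times> 'h \<Rightarrow>\<^sub>0 'k) set"
    and \<epsilon> :: "'h \<Rightarrow> 'k" +
  assumes antipode_exists: "\<exists>S. is_antipode S"

end

theory Submission
  imports Defs
begin

text \<open>
  If \<open>S\<close> is an antipode, then \<open>g \<otimes> h \<mapsto> g\<^sub>1 \<otimes> S(g\<^sub>2) h\<close> is inverse to \<open>\<beta>\<close>: one composite is the
  identity since \<open>g\<^sub>1 \<epsilon>\<^sub>s(g\<^sub>2) = g\<close>, the other is left multiplication by \<open>\<Delta>(1)\<close> since
  \<open>g\<^sub>1 \<otimes> \<epsilon>\<^sub>t(g\<^sub>2) = 1\<^sub>1 g \<otimes> 1\<^sub>2\<close>. Conversely, \<open>\<gamma>(X) = \<beta>\<^sup>-\<^sup>1(\<Delta>(1) X)\<close> is right \<open>H\<close>-linear, and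
  \<open>g \<otimes> h \<mapsto> \<epsilon>\<^sub>s(g) h\<close> is well defined on \<open>H \<otimes>\<^bsub>H_s\<^esub> H\<close>; the antipode is the composite of the two,
  evaluated at \<open>g \<otimes> 1\<close>. The axiom for \<open>S(h\<^sub>1) h\<^sub>2\<close> is then \<open>\<gamma> \<circ> \<beta> = id\<close>. For \<open>h\<^sub>1 S(h\<^sub>2)\<close>, the maps
  \<open>g \<otimes> z \<mapsto> g\<^sub>1 S(g\<^sub>2) z\<close> and \<open>g \<otimes> z \<mapsto> \<epsilon>(g) z\<close> both become multiplication after composition
  with \<open>\<beta>\<close>, so that they agree on \<open>\<Delta>(1)(H \<otimes> H)\<close>, in particular at \<open>\<Delta>(1)(h \<otimes> 1)\<close>.

  A Sweedler sum is treated as an integral against \<open>\<Delta>(h)\<close>: the axioms become identities between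
  iterated sums of arbitrary bilinear or trilinear maps into a vector space.
\<close>

section \<open>Quotients of free spaces\<close>

abbreviation lin ::
    "('k::field \<Rightarrow> 'v \<Rightarrow> 'v::ab_group_add) \<Rightarrow> ('k \<Rightarrow> 'w \<Rightarrow> 'w::ab_group_add) \<Rightarrow> ('v \<Rightarrow> 'w) \<Rightarrow> bool" where
  "lin \<equiv> Vector_Spaces.linear"

lemma lin_compose: "lin s1 s2 f \<Longrightarrow> lin s2 s3 g \<Longrightarrow> lin s1 s3 (\<lambda>x. g (f x))"
  by (auto simp: Vector_Spaces.linear_iff)

lemma lin_diff: "lin s1 s2 f \<Longrightarrow> f (x - y) = f x - f y"
  by (metis linear_iff_module_hom module_hom.diff)

lemma vector_space_fscale: "vector_space (fscale :: 'k::field \<Rightarrow> ('x \<Rightarrow>\<^sub>0 'k) \<Rightarrow> _)"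
  by unfold_locales

lemma lin_fscale_lin_ext: "lin fscale fscale (lin_ext fscale f)"
  by (rule linear_lin_ext[OF vector_space_fscale])

lemma lin_ext_basis:
  fixes f :: "'x \<Rightarrow> 'v::ab_group_add"
  assumes "vector_space sc"
  shows "lin_ext sc f (basis x) = f x"
proof -
  interpret vector_space sc by fact
  show ?thesis by (simp add: lin_ext_def basis_def)
qed

lemma lin_ext_basis_self: "lin_ext fscale basis u = u"
proof (rule poly_mapping_eqI)
  fix k
  have "Poly_Mapping.lookup (lin_ext fscale basis u) k =
      (\<Sum>x\<in>Poly_Mapping.keys u. Poly_Mapping.lookup u x * (1 when x = k))"
    unfolding lin_ext_def by (simp add: Poly_Mapping.lookup_sum basis_def Poly_Mapping.lookup_single)
  also have "\<dots> = (\<Sum>x\<in>Poly_Mapping.keys u. if x = k then Poly_Mapping.lookup u x else 0)"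
    by (intro sum.cong) (auto simp: when_def)
  also have "\<dots> = Poly_Mapping.lookup u k"
    by (auto simp: in_keys_iff)
  finally show "Poly_Mapping.lookup (lin_ext fscale basis u) k = Poly_Mapping.lookup u k" .
qed

lemma lin_lin_ext:
  assumes "lin sc sc' L"
  shows "L (lin_ext sc f u) = lin_ext sc' (\<lambda>x. L (f x)) u"
proof -
  interpret Vector_Spaces.linear sc sc' L by fact
  show ?thesis by (simp add: lin_ext_def sum scale)
qed

lemma lin_eq_on_basis:
  assumes "lin fscale sc F" "lin fscale sc G" "\<And>x. F (basis x) = G (basis x)"
  shows "F u = G u"
  using lin_lin_ext[OF assms(1), of basis u] lin_lin_ext[OF assms(2), of basis u] assms(3)
  by (simp add: lin_ext_basis_self)

text \<open>Since \<open>F\<close> kills the relations \<open>G\<close>, the representatives chosen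
  inside \<open>qlift\<close> do not matter. This turns the nested tensor-valued lifts in the axioms
  into iterated sums.\<close>

lemma vlift_qlift:
  assumes "vector_space sc" and "\<forall>r\<in>G. lin_ext sc F r = 0"
  shows "vlift sc F (qlift (free.span G) f X) = vlift sc (\<lambda>x. vlift sc F (f x)) X"
proof -
  have "vlift sc F (qlift (free.span G) f X) =
      lin_ext sc F (lin_ext fscale (\<lambda>x. rep (f x)) (rep X))"
    unfolding qlift_def by (rule vlift_qcls[OF assms])
  also have "\<dots> = lin_ext sc (\<lambda>x. lin_ext sc F (rep (f x))) (rep X)"
    by (rule lin_lin_ext) (rule linear_lin_ext[OF assms(1)])
  finally show ?thesis by (simp add: vlift_def)
qed

lemma lin_eq_0_on_span:
  assumes "lin fscale sc F" "\<forall>r\<in>G. F r = 0" "r \<in> free.span G"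
  shows "F r = 0"
  using assms(2,3) Vector_Spaces.linear.axioms
  by (metis assms(1) linear_iff_module_hom module_hom.eq_0_on_span)

lemma qcls_rep:
  assumes "X \<in> quot R" "free.subspace R"
  shows "qcls R (rep X) = X"
proof -
  obtain u where u: "X = qcls R u" using assms(1) by (auto simp: quot_def)
  obtain r where "r \<in> R" "rep (qcls R u) = u + r" using rep_qcls[OF assms(2)] .
  then show ?thesis by (simp add: u qcls_eq_iff[OF assms(2)])
qed

lemma qadd_qcls:
  assumes "free.subspace R"
  shows "qadd R (qcls R u) (qcls R v) = qcls R (u + v)"
proof -
  obtain r where r: "r \<in> R" "rep (qcls R u) = u + r" using rep_qcls[OF assms] .
  obtain r' where r': "r' \<in> R" "rep (qcls R v) = v + r'" using rep_qcls[OF assms] .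
  show ?thesis
    using free.subspace_add[OF assms r(1) r'(1)]
    by (simp add: qadd_def r r' qcls_eq_iff[OF assms] algebra_simps)
qed

lemma qscale_qcls:
  assumes "free.subspace R"
  shows "qscale R c (qcls R u) = qcls R (fscale c u)"
proof -
  obtain r where r: "r \<in> R" "rep (qcls R u) = u + r" using rep_qcls[OF assms] .
  show ?thesis
    using free.subspace_scale[OF assms r(1)]
    by (simp add: qscale_def r qcls_eq_iff[OF assms] free.scale_right_distrib)
qed

text \<open>A linear projection of a free space with kernel \<open>R\<close> identifies the quotient by \<open>R\<close> with a
  subspace of the free space, so that linear algebra over types applies to it.\<close>

definition nf :: "('x \<Rightarrow>\<^sub>0 'k::field) set \<Rightarrow> ('x \<Rightarrow>\<^sub>0 'k) \<Rightarrow> ('x \<Rightarrow>\<^sub>0 'k)" where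
  "nf R = (SOME p. lin fscale fscale p \<and> (\<forall>u. p u - u \<in> R) \<and> (\<forall>r\<in>R. p r = 0))"

text \<open>Over a field the inclusion of \<open>R\<close> has a linear left inverse
  \<open>q\<close>, and \<open>u - q u\<close> is the projection that the choice in
  \<open>nf\<close> asks for.\<close>

lemma nf_props:
  assumes R: "free.subspace (R :: ('x \<Rightarrow>\<^sub>0 'k::field) set)"
  shows "lin fscale fscale (nf R)" "nf R u - u \<in> R" "r \<in> R \<Longrightarrow> nf R r = 0"
proof -
  interpret P: vector_space_pair "fscale :: 'k \<Rightarrow> ('x \<Rightarrow>\<^sub>0 'k) \<Rightarrow> _" "fscale :: 'k \<Rightarrow> ('x \<Rightarrow>\<^sub>0 'k) \<Rightarrow> _"
    by unfold_locales
  have "lin fscale fscale (\<lambda>u :: 'x \<Rightarrow>\<^sub>0 'k. u)"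
    by (simp add: Vector_Spaces.linear_iff vector_space_fscale)
  from P.linear_exists_left_inverse_on[OF this R]
  obtain q :: "('x \<Rightarrow>\<^sub>0 'k) \<Rightarrow> _" where q: "range q \<subseteq> R" "lin fscale fscale q" "\<And>v. v \<in> R \<Longrightarrow> q v = v"
    by (auto simp: inj_on_def)
  have "lin fscale fscale (\<lambda>u. u - q u)"
    using q(2) by (auto simp: Vector_Spaces.linear_iff free.scale_right_diff_distrib)
  moreover have "(u - q u) - u \<in> R" for u
    using q(1) free.subspace_neg[OF R] by auto
  ultimately have "\<exists>p. lin fscale fscale p \<and> (\<forall>u. p u - u \<in> R) \<and> (\<forall>r\<in>R. p r = 0)"
    using q(3) by (intro exI[of _ "\<lambda>u. u - q u"]) auto
  from someI_ex[OF this, folded nf_def]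
  show "lin fscale fscale (nf R)" "nf R u - u \<in> R" "r \<in> R \<Longrightarrow> nf R r = 0" by auto
qed

lemma nf_eq_iff:
  assumes R: "free.subspace R"
  shows "nf R u = nf R v \<longleftrightarrow> u - v \<in> R"
proof
  assume "nf R u = nf R v"
  then have "u - v = (nf R v - v) - (nf R u - u)" by simp
  then show "u - v \<in> R"
    using free.subspace_diff[OF R nf_props(2)[OF R] nf_props(2)[OF R]] by metis
next
  assume "u - v \<in> R"
  then show "nf R u = nf R v"
    using nf_props(3)[OF R] lin_diff[OF nf_props(1)[OF R]] by fastforce
qed

lemma qcls_eq_iff_nf:
  assumes "free.subspace R"
  shows "qcls R u = qcls R v \<longleftrightarrow> nf R u = nf R v"
  by (simp add: nf_eq_iff qcls_eq_iff assms)

lemma nf_nf: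
  assumes "free.subspace R"
  shows "nf R (nf R u) = nf R u"
  by (simp add: nf_eq_iff nf_props(2) assms)

lemma lin_nf:
  assumes "lin fscale sc F" "\<forall>r\<in>G. F r = 0"
  shows "F (nf (free.span G) u) = F u"
  using lin_eq_0_on_span[OF assms nf_props(2)[OF free.subspace_span]] lin_diff[OF assms(1)]
  by (metis eq_iff_diff_eq_0)

lemma qcls_nf:
  assumes "free.subspace R"
  shows "qcls R (nf R u) = qcls R u"
  by (simp add: qcls_eq_iff nf_props(2) assms)

lemma nf_rep_qcls:
  assumes "free.subspace R"
  shows "nf R (rep (qcls R u)) = nf R u"
  using rep_qcls[OF assms, of u] by (metis add_diff_cancel_left' nf_eq_iff[OF assms])

text \<open>Normal forms replace arbitrary representatives by ones that depend linearly on the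
  coset, so that a coset-valued lift becomes a vector-valued one.\<close>

lemma qlift_eq_qcls:
  assumes "free.subspace R"
  shows "qlift R f X = qcls R (vlift fscale (\<lambda>x. nf R (rep (f x))) X)"
  unfolding qlift_def vlift_def
  by (simp add: lin_lin_ext[OF nf_props(1)[OF assms], symmetric] qcls_nf[OF assms])

section \<open>Multilinear maps on tensor products\<close>

definition bilin ::
    "('k::field \<Rightarrow> 'v \<Rightarrow> 'v::ab_group_add) \<Rightarrow> ('k \<Rightarrow> 'w \<Rightarrow> 'w::ab_group_add) \<Rightarrow> ('v \<Rightarrow> 'v \<Rightarrow> 'w) \<Rightarrow> bool" where
  "bilin s sc f \<longleftrightarrow> (\<forall>b. lin s sc (\<lambda>a. f a b)) \<and> (\<forall>a. lin s sc (\<lambda>b. f a b))"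

definition trilin ::
    "('k::field \<Rightarrow> 'v \<Rightarrow> 'v::ab_group_add) \<Rightarrow> ('k \<Rightarrow> 'w \<Rightarrow> 'w::ab_group_add) \<Rightarrow> ('v \<Rightarrow> 'v \<Rightarrow> 'v \<Rightarrow> 'w) \<Rightarrow> bool" where
  "trilin s sc f \<longleftrightarrow> (\<forall>b d. lin s sc (\<lambda>a. f a b d)) \<and> (\<forall>a d. lin s sc (\<lambda>b. f a b d)) \<and>
    (\<forall>a b. lin s sc (\<lambda>d. f a b d))"

lemma bilinI: "(\<And>b. lin s sc (\<lambda>a. f a b)) \<Longrightarrow> (\<And>a. lin s sc (\<lambda>b. f a b)) \<Longrightarrow> bilin s sc f"
  by (simp add: bilin_def)

lemma trilinI:
  "(\<And>b d. lin s sc (\<lambda>a. f a b d)) \<Longrightarrow> (\<And>a d. lin s sc (\<lambda>b. f a b d)) \<Longrightarrow> (\<And>a b. lin s sc (\<lambda>d. f a b d))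
    \<Longrightarrow> trilin s sc f"
  by (simp add: trilin_def)

lemma bilinD:
  assumes "bilin s sc f"
  shows "vector_space sc" "f (a + a') b = f a b + f a' b" "f a (b + b') = f a b + f a b'"
    "f (s c a) b = sc c (f a b)" "f a (s c b) = sc c (f a b)"
  using assms by (auto simp: bilin_def Vector_Spaces.linear_iff)

lemma trilinD:
  assumes "trilin s sc f"
  shows "vector_space sc" "f (a + a') b d = f a b d + f a' b d" "f a (b + b') d = f a b d + f a b' d"
    "f a b (d + d') = f a b d + f a b d'"
    "f (s c a) b d = sc c (f a b d)" "f a (s c b) d = sc c (f a b d)" "f a b (s c d) = sc c (f a b d)"
  using assms by (auto simp: trilin_def Vector_Spaces.linear_iff)

lemma bilin_rel2:
  assumes f: "bilin s sc f"
  shows "\<forall>r\<in>rel2 s. lin_ext sc (\<lambda>(a, b). f a b) r = 0"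
proof -
  note vs = bilinD(1)[OF f]
  interpret L: Vector_Spaces.linear fscale sc "lin_ext sc (\<lambda>(a, b). f a b)"
    by (rule linear_lin_ext[OF vs])
  show ?thesis
    by (auto simp: rel2_def L.diff L.scale lin_ext_basis[OF vs] bilinD(2-)[OF f])
qed

lemma trilin_rel3:
  assumes f: "trilin s sc f"
  shows "\<forall>r\<in>rel3 s. lin_ext sc (\<lambda>(a, b, d). f a b d) r = 0"
proof -
  note vs = trilinD(1)[OF f]
  interpret L: Vector_Spaces.linear fscale sc "lin_ext sc (\<lambda>(a, b, d). f a b d)"
    by (rule linear_lin_ext[OF vs])
  show ?thesis
    by (auto simp: rel3_def L.diff L.scale lin_ext_basis[OF vs] trilinD(2-)[OF f])
qed

lemma subspace_ker2: "free.subspace (ker2 s)"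
  by (simp add: ker2_def)

lemma vlift_ker2:
  assumes "bilin s sc f"
  shows "vlift sc (\<lambda>(a, b). f a b) (qcls (ker2 s) u) = lin_ext sc (\<lambda>(a, b). f a b) u"
  unfolding ker2_def by (rule vlift_qcls[OF bilinD(1)[OF assms] bilin_rel2[OF assms]])

lemma vlift_tens2:
  assumes "bilin s sc f"
  shows "vlift sc (\<lambda>(a, b). f a b) (tens2 s x y) = f x y"
  unfolding tens2_def
  by (simp add: vlift_ker2[OF assms] lin_ext_basis[OF bilinD(1)[OF assms]])

lemma vlift_tens3:
  assumes "trilin s sc f"
  shows "vlift sc (\<lambda>(a, b, d). f a b d) (tens3 s x y z) = f x y z"
  unfolding tens3_def ker3_def
  by (simp add: vlift_qcls[OF trilinD(1)[OF assms] trilin_rel3[OF assms]] lin_ext_basis[OF trilinD(1)[OF assms]])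

lemma vlift_qlift_ker2:
  assumes "bilin s sc F"
  shows "vlift sc (\<lambda>(a, b). F a b) (qlift (ker2 s) f X) =
    vlift sc (\<lambda>x. vlift sc (\<lambda>(a, b). F a b) (f x)) X"
  unfolding ker2_def by (rule vlift_qlift[OF bilinD(1)[OF assms] bilin_rel2[OF assms]])

lemma vlift_qlift_ker3:
  assumes "trilin s sc F"
  shows "vlift sc (\<lambda>(a, b, d). F a b d) (qlift (ker3 s) f X) =
    vlift sc (\<lambda>x. vlift sc (\<lambda>(a, b, d). F a b d) (f x)) X"
  unfolding ker3_def by (rule vlift_qlift[OF trilinD(1)[OF assms] trilin_rel3[OF assms]])

text \<open>The simple tensor of \<open>a\<close> and \<open>b\<close> modulo \<open>R\<close>, as a
  vector instead of a coset. It serves for the tensor product over the field and for the one over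
  \<open>H_s\<close> alike.\<close>

definition bal :: "('v \<times> 'v \<Rightarrow>\<^sub>0 'k::field) set \<Rightarrow> 'v \<Rightarrow> 'v \<Rightarrow> ('v \<times> 'v \<Rightarrow>\<^sub>0 'k)" where
  "bal R a b = nf R (basis (a, b))"

lemma bilin_bal:
  assumes s: "vector_space s" and R: "free.subspace R" and rel: "rel2 s \<subseteq> R"
  shows "bilin s fscale (bal R)"
proof -
  interpret N: Vector_Spaces.linear fscale fscale "nf R" by (rule nf_props(1)[OF R])
  have eq0: "nf R r = 0" if "r \<in> rel2 s" for r
    using nf_props(3)[OF R] that rel by blast
  have "bal R (a + a') b = bal R a b + bal R a' b" for a a' b
  proof -
    have "basis (a + a', b) - basis (a, b) - basis (a', b) \<in> rel2 s"
      unfolding rel2_def by blast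
    from eq0[OF this] show ?thesis
      by (simp add: bal_def N.diff N.add N.scale diff_diff_eq)
  qed
  moreover have "bal R a (b + b') = bal R a b + bal R a b'" for a b b'
  proof -
    have "basis (a, b + b') - basis (a, b) - basis (a, b') \<in> rel2 s"
      unfolding rel2_def by blast
    from eq0[OF this] show ?thesis
      by (simp add: bal_def N.diff N.add N.scale diff_diff_eq)
  qed
  moreover have "bal R (s c a) b = fscale c (bal R a b)" for c a b
  proof -
    have "basis (s c a, b) - fscale c (basis (a, b)) \<in> rel2 s"
      unfolding rel2_def by blast
    from eq0[OF this] show ?thesis
      by (simp add: bal_def N.diff N.add N.scale diff_diff_eq)
  qed
  moreover have "bal R a (s c b) = fscale c (bal R a b)" for c a b
  proof -
    have "basis (a, s c b) - fscale c (basis (a, b)) \<in> rel2 s"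
      unfolding rel2_def by blast
    from eq0[OF this] show ?thesis
      by (simp add: bal_def N.diff N.add N.scale diff_diff_eq)
  qed
  ultimately show ?thesis
    by (auto simp: bilin_def Vector_Spaces.linear_iff s vector_space_fscale)
qed

section \<open>Sweedler sums\<close>

lemma vector_space_mult: "vector_space ((*) :: 'k::field \<Rightarrow> 'k \<Rightarrow> 'k)"
  by unfold_locales (simp_all add: algebra_simps)

lemma lin_bilin_left: "bilin s sc f \<Longrightarrow> lin s' s g \<Longrightarrow> lin s' sc (\<lambda>x. f (g x) b)"
  and lin_bilin_right: "bilin s sc f \<Longrightarrow> lin s' s g \<Longrightarrow> lin s' sc (\<lambda>x. f a (g x))"
  by (auto simp: bilin_def intro: lin_compose)

lemma lin_trilin:
  assumes "trilin s sc f" "lin s' s g"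
  shows "lin s' sc (\<lambda>x. f (g x) b d)" "lin s' sc (\<lambda>x. f a (g x) d)" "lin s' sc (\<lambda>x. f a b (g x))"
  using assms by (auto simp: trilin_def intro: lin_compose)

lemma lin_scale_fun: "lin s (*) f \<Longrightarrow> vector_space sc \<Longrightarrow> lin s sc (\<lambda>x. sc (f x) v)"
  by (auto simp: Vector_Spaces.linear_iff vector_space_def algebra_simps)

lemma lin_scale_const: "lin s sc f \<Longrightarrow> lin s sc (\<lambda>x. sc c (f x))"
  by (auto simp: Vector_Spaces.linear_iff vector_space_def mult.commute)

section \<open>Linearity, counit and coassociativity for Sweedler sums\<close>

context coalgebra
begin

text \<open>\<open>sw sc h f\<close> is the Sweedler sum of \<open>f h\<^sub>1 h\<^sub>2\<close>, with values in a vector space.\<close>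

definition sw :: "('k \<Rightarrow> 'v \<Rightarrow> 'v::ab_group_add) \<Rightarrow> 'h \<Rightarrow> ('h \<Rightarrow> 'h \<Rightarrow> 'v) \<Rightarrow> 'v" where
  "sw sc h f = vlift sc (\<lambda>(a, b). f a b) (\<Delta> h)"

lemma vector_space_scale: "vector_space scale"
  by (rule vector_space_axioms)

lemma lin_id: "lin scale scale (\<lambda>x. x)"
  by (simp add: Vector_Spaces.linear_iff vector_space_axioms)

lemma lin_counit: "lin s scale f \<Longrightarrow> lin s (*) (\<lambda>x. \<epsilon> (f x))"
  by (rule lin_compose[OF _ counit_linear])

lemma sw_lin: "lin sc sc' L \<Longrightarrow> L (sw sc h f) = sw sc' h (\<lambda>a b. L (f a b))"
  by (simp add: sw_def vlift_def lin_lin_ext case_prod_unfold)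

text \<open>Fubini: both sides are finite sums over the fixed representatives of
  \<open>\<Delta> h\<close> and \<open>\<Delta> g\<close>.\<close>

lemma sw_swap:
  assumes "vector_space sc"
  shows "sw sc h (\<lambda>a b. sw sc g (\<lambda>c d. f a b c d)) = sw sc g (\<lambda>c d. sw sc h (\<lambda>a b. f a b c d))"
proof -
  interpret V: vector_space sc by fact
  show ?thesis
    unfolding sw_def vlift_def lin_ext_def case_prod_unfold
    by (simp add: V.scale_sum_right, subst sum.swap, simp add: mult.commute)
qed

lemma lin_sw:
  assumes "\<And>a b. lin s sc (\<lambda>x. f x a b)"
  shows "lin s sc (\<lambda>x. sw sc h (\<lambda>a b. f x a b))"
proof -
  from assms have "vector_space s" "vector_space sc"
    by (auto simp: Vector_Spaces.linear_iff)
  interpret V: vector_space sc by fact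
  have "f (x + y) a b = f x a b + f y a b" "f (s c x) a b = sc c (f x a b)" for x y c a b
    using assms[of a b] by (auto simp: Vector_Spaces.linear_iff)
  then show ?thesis
    using \<open>vector_space s\<close> \<open>vector_space sc\<close>
    by (auto simp: Vector_Spaces.linear_iff sw_def vlift_def lin_ext_def case_prod_unfold
        V.scale_right_distrib sum.distrib V.scale_sum_right mult.commute intro!: sum.cong)
qed

lemma sw_qcls:
  assumes "bilin scale sc f" "\<Delta> h = qcls (ker2 scale) u"
  shows "sw sc h f = lin_ext sc (\<lambda>(a, b). f a b) u"
  unfolding sw_def assms(2) by (rule vlift_ker2[OF assms(1)])

text \<open>The representative of \<open>\<Delta> (g + h)\<close> may differ from the sum of those
  of \<open>\<Delta> g\<close> and \<open>\<Delta> h\<close>. Bilinearity of \<open>f\<close> makes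
  the Sweedler sum independent of the choice, so linearity of \<Delta> carries over.\<close>

lemma lin_sw_arg:
  assumes f: "bilin scale sc f" and g: "lin s scale g"
  shows "lin s sc (\<lambda>x. sw sc (g x) f)"
proof (rule lin_compose[OF g, of sc "\<lambda>h. sw sc h f"])
  interpret L: Vector_Spaces.linear fscale sc "lin_ext sc (\<lambda>(a, b). f a b)"
    by (rule linear_lin_ext[OF bilinD(1)[OF f]])
  have \<Delta>: "\<Delta> h = qcls (ker2 scale) (rep (\<Delta> h))" for h
    by (simp add: qcls_rep[OF comult_closed subspace_ker2])
  have "\<Delta> (g + h) = qcls (ker2 scale) (rep (\<Delta> g) + rep (\<Delta> h))" for g h
    by (metis \<Delta> comult_add qadd_qcls subspace_ker2)
  moreover have "\<Delta> (scale c h) = qcls (ker2 scale) (fscale c (rep (\<Delta> h)))" for c h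
    by (metis \<Delta> comult_scale qscale_qcls subspace_ker2)
  ultimately have "sw sc (g + h) f = sw sc g f + sw sc h f" "sw sc (scale c h) f = sc c (sw sc h f)" for g h c
    using sw_qcls[OF f] \<Delta> by (metis L.add, metis L.scale)
  then show "lin scale sc (\<lambda>h. sw sc h f)"
    using bilinD(1)[OF f] vector_space_axioms by (simp add: Vector_Spaces.linear_iff)
qed

lemma sw_counit_left:
  assumes "lin scale sc f"
  shows "sw sc h (\<lambda>a b. sc (\<epsilon> a) (f b)) = f h"
  using sw_lin[OF assms, of h "\<lambda>a b. scale (\<epsilon> a) b"] assms
  by (simp add: sw_def counit_left Vector_Spaces.linear_iff)

lemma sw_counit_right:
  assumes "lin scale sc f"
  shows "sw sc h (\<lambda>a b. sc (\<epsilon> b) (f a)) = f h"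
  using sw_lin[OF assms, of h "\<lambda>a b. scale (\<epsilon> b) a"] assms
  by (simp add: sw_def counit_right Vector_Spaces.linear_iff)

lemma vlift_comult2:
  assumes f: "trilin scale sc f"
  shows "vlift sc (\<lambda>(a, b, d). f a b d) (comult2 h) = sw sc h (\<lambda>a b. sw sc a (\<lambda>p q. f p q b))"
  unfolding comult2_def sw_def
  by (simp add: vlift_qlift_ker3[OF f, unfolded case_prod_unfold] case_prod_unfold
      vlift_tens3[OF f, unfolded case_prod_unfold])

lemma sw_coassoc:
  assumes f: "trilin scale sc f"
  shows "sw sc h (\<lambda>a b. sw sc a (\<lambda>p q. f p q b)) = sw sc h (\<lambda>a b. sw sc b (\<lambda>p q. f a p q))"
  unfolding vlift_comult2[OF f, symmetric] comult2_def coassoc unfolding sw_def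
  by (simp add: vlift_qlift_ker3[OF f, unfolded case_prod_unfold] case_prod_unfold
      vlift_tens3[OF f, unfolded case_prod_unfold])

end

context unital_algebra
begin

lemma lin_mult_left: "lin s scale f \<Longrightarrow> lin s scale (\<lambda>x. f x * c)"
  and lin_mult_right: "lin s scale f \<Longrightarrow> lin s scale (\<lambda>x. c * f x)"
  by (auto simp: Vector_Spaces.linear_iff algebra_simps scale_mult_left scale_mult_right)

end

section \<open>Sweedler sums over products and over the unit\<close>

context weak_bialgebra
begin

text \<open>Rules by which \<open>intro\<close> reduces multilinearity of a Sweedler expression to
  linearity of its building blocks.\<close>

lemmas lin_intros = bilinI trilinI lin_id lin_mult_left lin_mult_right lin_counit lin_sw
  lin_scale_fun[OF _ vector_space_scale] lin_scale_const[of _ scale]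
  lin_scale_fun[OF _ vector_space_fscale] lin_scale_const[of _ fscale]
  lin_scale_fun[OF _ vector_space_mult] lin_scale_const[of _ "(*)"]

lemma sw_mult:
  assumes f: "bilin scale sc f"
  shows "sw sc (g * h) f = sw sc g (\<lambda>a b. sw sc h (\<lambda>c d. f (a * c) (b * d)))"
  unfolding sw_def comult_mult mult2_def
  by (simp add: vlift_qlift_ker2[OF f, unfolded case_prod_unfold] case_prod_unfold
      vlift_tens2[OF f, unfolded case_prod_unfold])

text \<open>As \<open>g * 1 = g = 1 * g\<close>, multiplicativity lets \<open>\<Delta> g\<close>
  absorb \<open>\<Delta> 1\<close> on either side. This stands in for the missing law
  \<open>\<Delta>(1) = 1 \<otimes> 1\<close>.\<close>

lemma sw_mult_one:
  assumes f: "bilin scale sc f"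
  shows "sw sc g (\<lambda>a b. sw sc 1 (\<lambda>c d. f (a * c) (b * d))) = sw sc g f"
    "sw sc 1 (\<lambda>a b. sw sc g (\<lambda>c d. f (a * c) (b * d))) = sw sc g f"
  by (simp_all add: sw_mult[OF f, symmetric])

lemma vlift_mult3:
  assumes f: "trilin scale sc f"
  shows "vlift sc (\<lambda>(a, b, d). f a b d) (mult3 X Y) =
    vlift sc (\<lambda>(a, b, d). vlift sc (\<lambda>(a', b', d'). f (a * a') (b * b') (d * d')) Y) X"
  unfolding mult3_def
  by (simp add: vlift_qlift_ker3[OF f, unfolded case_prod_unfold] case_prod_unfold
      vlift_tens3[OF f, unfolded case_prod_unfold])

lemma vlift_tensor_one:
  assumes f: "trilin scale sc f"
  shows "vlift sc (\<lambda>(a, b, d). f a b d) (tensor_one (\<Delta> h)) = sw sc h (\<lambda>a b. f a b 1)"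
    and "vlift sc (\<lambda>(a, b, d). f a b d) (one_tensor (\<Delta> h)) = sw sc h (\<lambda>a b. f 1 a b)"
  unfolding tensor_one_def one_tensor_def sw_def
  by (simp_all add: vlift_qlift_ker3[OF f, unfolded case_prod_unfold] case_prod_unfold
      vlift_tens3[OF f, unfolded case_prod_unfold])

text \<open>The two axioms for \<open>comult2 1\<close>. In the second one the sums are exchanged,
  so that \<open>a\<close>, \<open>b\<close> always come from \<open>\<Delta>(1) \<otimes> 1\<close>
  and \<open>c\<close>, \<open>d\<close> from \<open>1 \<otimes> \<Delta>(1)\<close>.\<close>

lemma sw_comult_one:
  assumes f: "trilin scale sc f"
  shows "sw sc 1 (\<lambda>a b. sw sc a (\<lambda>p q. f p q b)) = sw sc 1 (\<lambda>a b. sw sc 1 (\<lambda>c d. f a (b * c) d))"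
    and "sw sc 1 (\<lambda>a b. sw sc a (\<lambda>p q. f p q b)) = sw sc 1 (\<lambda>a b. sw sc 1 (\<lambda>c d. f a (c * b) d))"
proof -
  note lins = lin_intros lin_trilin[OF f]
  have T: "trilin scale sc (\<lambda>a' b' d'. f (a * a') (b * b') (d * d'))" for a b d
    by (intro lins)
  have T': "trilin scale sc (\<lambda>a b d. sw sc 1 (\<lambda>p q. f (a * 1) (b * p) (d * q)))"
    "trilin scale sc (\<lambda>a b d. sw sc 1 (\<lambda>p q. f (a * p) (b * q) (d * 1)))"
    by (intro lins)+
  show "sw sc 1 (\<lambda>a b. sw sc a (\<lambda>p q. f p q b)) = sw sc 1 (\<lambda>a b. sw sc 1 (\<lambda>c d. f a (b * c) d))"
    using vlift_tensor_one(1)[OF T'(1)]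
    by (simp add: vlift_comult2[OF f, symmetric] comult_one_12 vlift_mult3[OF f] vlift_tensor_one(2)[OF T])
  show "sw sc 1 (\<lambda>a b. sw sc a (\<lambda>p q. f p q b)) = sw sc 1 (\<lambda>a b. sw sc 1 (\<lambda>c d. f a (c * b) d))"
    using vlift_tensor_one(2)[OF T'(2)]
    by (simp add: vlift_comult2[OF f, symmetric] comult_one_21 vlift_mult3[OF f] vlift_tensor_one(1)[OF T]
      sw_swap[OF trilinD(1)[OF f], of 1 1 "\<lambda>a b c d. f a (c * b) d"])
qed

lemma counit_mult:
  "\<epsilon> (f * g * h) = sw (*) g (\<lambda>a b. \<epsilon> (f * a) * \<epsilon> (b * h))"
  "\<epsilon> (f * g * h) = sw (*) g (\<lambda>a b. \<epsilon> (f * b) * \<epsilon> (a * h))"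
  by (simp_all add: sw_def counit_mult_12 flip: counit_mult_21)

section \<open>The counital maps and the source counital subalgebra\<close>

lemma eps_s_sw: "eps_s h = sw scale 1 (\<lambda>a b. scale (\<epsilon> (h * b)) a)"
  by (simp add: eps_s_def sw_def)

lemma eps_t_sw: "eps_t h = sw scale 1 (\<lambda>a b. scale (\<epsilon> (a * h)) b)"
  by (simp add: eps_t_def sw_def)

lemma lin_eps_s: "lin s scale f \<Longrightarrow> lin s scale (\<lambda>x. eps_s (f x))"
  unfolding eps_s_sw by (intro lin_intros)

lemma lin_eps_t: "lin s scale f \<Longrightarrow> lin s scale (\<lambda>x. eps_t (f x))"
  unfolding eps_t_sw by (intro lin_intros)

text \<open>In \<open>1\<^sub>1 \<epsilon>(y 1\<^sub>2)\<close>, comultiply the first leg and insert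
  either formula for \<open>comult2 1\<close>; the inner copy of \<open>\<Delta>(1)\<close> then
  collapses to \<open>eps_s y\<close>, on the right or on the left of the second leg.\<close>

lemma sw_eps_s:
  assumes f: "bilin scale sc f"
  shows "sw sc (eps_s y) f = sw sc 1 (\<lambda>a b. f a (b * eps_s y))"
    and "sw sc (eps_s y) f = sw sc 1 (\<lambda>a b. f a (eps_s y * b))"
proof -
  note vs = bilinD(1)[OF f]
  note lins = lin_intros lin_scale_fun[OF _ vs] lin_scale_const[of _ sc] lin_bilin_left[OF f] lin_bilin_right[OF f]
  have T: "trilin scale sc (\<lambda>p q b. sc (\<epsilon> (y * b)) (f p q))"
    by (intro lins)
  have L: "lin scale sc (\<lambda>z. f a (b * z))" "lin scale sc (\<lambda>z. f a (z * b))" for a b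
    by (intro lins)+
  have Lc: "lin sc sc (sc c)" for c
    by (rule lin_scale_const) (simp add: Vector_Spaces.linear_iff vs)
  have "sw sc (eps_s y) f = sw sc 1 (\<lambda>a b. sw sc (scale (\<epsilon> (y * b)) a) f)"
    unfolding eps_s_sw by (rule sw_lin, rule lin_sw_arg[OF f lin_id])
  also have "\<dots> = sw sc 1 (\<lambda>a b. sc (\<epsilon> (y * b)) (sw sc a f))"
    using lin_sw_arg[OF f lin_id] by (simp add: Vector_Spaces.linear_iff)
  also have "\<dots> = sw sc 1 (\<lambda>a b. sw sc a (\<lambda>p q. sc (\<epsilon> (y * b)) (f p q)))"
    by (simp add: sw_lin[OF Lc])
  finally have *: "sw sc (eps_s y) f = sw sc 1 (\<lambda>a b. sw sc a (\<lambda>p q. sc (\<epsilon> (y * b)) (f p q)))" .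
  show "sw sc (eps_s y) f = sw sc 1 (\<lambda>a b. f a (b * eps_s y))"
    unfolding * sw_comult_one(1)[OF T] unfolding eps_s_sw
    by (simp add: sw_lin[OF L(1)] bilinD[OF f] scale_mult_right)
  show "sw sc (eps_s y) f = sw sc 1 (\<lambda>a b. f a (eps_s y * b))"
    unfolding * sw_comult_one(2)[OF T] unfolding eps_s_sw
    by (simp add: sw_lin[OF L(2)] bilinD[OF f] scale_mult_left)
qed

lemma eps_s_in_H_s: "eps_s y \<in> H_s"
  by (simp add: H_s_def)

text \<open>\<open>\<Delta>(x) = \<Delta>(1)(1 \<otimes> x)\<close> for \<open>x\<close> in
  \<open>H_s\<close>, and \<open>\<Delta>(g)\<close> absorbs \<open>\<Delta>(1)\<close>. This is why
  \<beta> is well defined over \<open>H_s\<close>.\<close>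

lemma sw_mult_H_s:
  assumes f: "bilin scale sc f" and x: "x \<in> H_s"
  shows "sw sc (g * x) f = sw sc g (\<lambda>a b. f a (b * x))"
proof -
  note lins = lin_intros lin_bilin_left[OF f] lin_bilin_right[OF f]
  obtain y where y: "x = eps_s y" using x by (auto simp: H_s_def)
  have b1: "bilin scale sc (\<lambda>c d. f (a * c) (b * d))" for a b by (intro lins)
  have b2: "bilin scale sc (\<lambda>a b. f a (b * x))" by (intro lins)
  have "sw sc (g * x) f = sw sc g (\<lambda>a b. sw sc 1 (\<lambda>c d. f (a * c) (b * d * x)))"
    unfolding sw_mult[OF f] unfolding y by (simp add: sw_eps_s(1)[OF b1] mult.assoc)
  also have "\<dots> = sw sc g (\<lambda>a b. f a (b * x))"
    by (rule sw_mult_one[OF b2])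
  finally show ?thesis .
qed

text \<open>Both \<open>\<Delta>(x)\<close> and \<open>\<Delta>(y)\<close> have the form
  \<open>1\<^sub>1 \<otimes> z 1\<^sub>2\<close>, hence so does \<open>\<Delta>(x y)\<close>, with
  \<open>z = x y\<close>. Applying the counit to the second leg gives the claim; in particular
  \<open>H_s\<close> is closed under products.\<close>

lemma eps_s_H_s_mult:
  assumes x: "x \<in> H_s" and y: "y \<in> H_s"
  shows "eps_s (x * y) = x * y"
proof -
  have *: "sw sc z f = sw sc 1 (\<lambda>a b. f a (z * b))"
    if "bilin scale sc f" "z \<in> H_s" for z sc and f :: "'h \<Rightarrow> 'h \<Rightarrow> 'h"
    using that sw_eps_s(2) by (auto simp: H_s_def)
  have b0: "bilin scale scale (\<lambda>a b. scale (\<epsilon> b) a)" by (intro lin_intros)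
  have b2: "bilin scale scale (\<lambda>a b. scale (\<epsilon> (x * b)) a)" by (intro lin_intros)
  have b3: "bilin scale scale (\<lambda>a b. sw scale y (\<lambda>c d. scale (\<epsilon> (b * d)) (a * c)))"
    by (intro lin_intros)
  have "x * y = sw scale (x * y) (\<lambda>a b. scale (\<epsilon> b) a)"
    by (simp add: sw_counit_right[OF lin_id])
  also have "\<dots> = sw scale x (\<lambda>a b. sw scale y (\<lambda>c d. scale (\<epsilon> (b * d)) (a * c)))"
    by (rule sw_mult[OF b0])
  also have "\<dots> = sw scale 1 (\<lambda>a b. sw scale y (\<lambda>c d. scale (\<epsilon> (x * (b * d))) (a * c)))"
    by (simp add: *[OF b3 x] mult.assoc)
  also have "\<dots> = sw scale y (\<lambda>a b. scale (\<epsilon> (x * b)) a)"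
    by (rule sw_mult_one[OF b2])
  also have "\<dots> = eps_s (x * y)"
    by (simp add: *[OF b2 y] eps_s_sw mult.assoc)
  finally show ?thesis by simp
qed

text \<open>The second counit axiom with middle factor \<open>1\<close> gives
  \<open>\<epsilon>(eps_s g * h) = \<epsilon>(g * h)\<close>. Hence
  \<open>eps_s (g * x) = eps_s (eps_s g * x)\<close>, where both factors \<open>eps_s g\<close> and
  \<open>x\<close> lie in \<open>H_s\<close>.\<close>

lemma eps_s_mult_H_s:
  assumes x: "x \<in> H_s"
  shows "eps_s (g * x) = eps_s g * x"
proof -
  have "\<epsilon> (eps_s g * h) = \<epsilon> (g * h)" for h
  proof -
    have L: "lin scale (*) (\<lambda>z. \<epsilon> (z * h))" by (intro lin_intros)
    show ?thesis
      using counit_mult(2)[of g 1 h] counit_linear unfolding eps_s_sw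
      by (simp add: sw_lin[OF L] scale_mult_left Vector_Spaces.linear_iff)
  qed
  then have "eps_s (eps_s g * x) = eps_s (g * x)"
    by (simp add: eps_s_sw mult.assoc)
  then show ?thesis
    using eps_s_H_s_mult[OF _ x, of "eps_s g"] by (simp add: H_s_def)
qed

text \<open>Written out, the sum is
  \<open>g\<^sub>1 1\<^sub>1 \<epsilon>(g\<^sub>2 1\<^sub>2)\<close>: absorb
  \<open>\<Delta>(1)\<close>, then apply the counit.\<close>

lemma sw_mult_eps_s:
  assumes f: "lin scale sc f"
  shows "sw sc g (\<lambda>a b. f (a * eps_s b)) = f g"
proof -
  have b: "bilin scale scale (\<lambda>a b. scale (\<epsilon> b) a)" by (intro lin_intros)
  have "sw scale g (\<lambda>a b. a * eps_s b) = sw scale g (\<lambda>a b. sw scale 1 (\<lambda>c d. scale (\<epsilon> (b * d)) (a * c)))"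
    unfolding eps_s_sw by (simp add: sw_lin[OF lin_mult_right[OF lin_id]] scale_mult_right)
  also have "\<dots> = g"
    by (simp add: sw_mult_one[OF b] sw_counit_right[OF lin_id])
  finally show ?thesis
    using sw_lin[OF f, of g "\<lambda>a b. a * eps_s b"] by simp
qed

text \<open>Expanding \<open>1\<^sub>1 g\<close> by the counit creates a \<open>comult2 1\<close>.
  Its second formula gathers one copy of \<open>\<Delta>(1)\<close> into \<open>eps_t\<close>, and
  \<open>\<Delta>(g)\<close> absorbs the other.\<close>

lemma sw_eps_t:
  assumes f: "bilin scale sc f"
  shows "sw sc g (\<lambda>a b. f a (eps_t b)) = sw sc 1 (\<lambda>a b. f (a * g) b)"
proof -
  note vs = bilinD(1)[OF f]
  note lins = lin_intros lin_scale_fun[OF _ vs] lin_scale_const[of _ sc] lin_bilin_left[OF f] lin_bilin_right[OF f]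
  have b1: "bilin scale sc (\<lambda>p q. sc (\<epsilon> q) (f p b))" for b by (intro lins)
  have T: "trilin scale sc (\<lambda>p q b. sw sc g (\<lambda>r s. sc (\<epsilon> (q * s)) (f (p * r) b)))" by (intro lins)
  have b2: "bilin scale sc (\<lambda>a b. f a (eps_t b))" by (intro lins lin_eps_t)
  have L: "lin scale sc (\<lambda>b. f a b)" for a by (intro lins)
  have "sw sc 1 (\<lambda>a b. f (a * g) b) = sw sc 1 (\<lambda>a b. sw sc (a * g) (\<lambda>p q. sc (\<epsilon> q) (f p b)))"
  proof -
    have "sw sc (a * g) (\<lambda>p q. sc (\<epsilon> q) (f p b)) = f (a * g) b" for a b
      by (rule sw_counit_right, intro lins)
    then show ?thesis by simp
  qed
  also have "\<dots> = sw sc 1 (\<lambda>a b. sw sc a (\<lambda>p q. sw sc g (\<lambda>r s. sc (\<epsilon> (q * s)) (f (p * r) b))))"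
    by (simp add: sw_mult[OF b1])
  also have "\<dots> = sw sc 1 (\<lambda>a b. sw sc 1 (\<lambda>c d. sw sc g (\<lambda>r s. sc (\<epsilon> (c * b * s)) (f (a * r) d))))"
    by (rule sw_comult_one(2)[OF T])
  also have "\<dots> = sw sc 1 (\<lambda>a b. sw sc g (\<lambda>r s. sw sc 1 (\<lambda>c d. sc (\<epsilon> (c * (b * s))) (f (a * r) d))))"
    by (simp add: sw_swap[OF vs, of 1 g] mult.assoc)
  also have "\<dots> = sw sc 1 (\<lambda>a b. sw sc g (\<lambda>r s. f (a * r) (eps_t (b * s))))"
    unfolding eps_t_sw by (simp add: sw_lin[OF L] bilinD[OF f])
  also have "\<dots> = sw sc g (\<lambda>a b. f a (eps_t b))"
    by (rule sw_mult_one[OF b2])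
  finally show ?thesis by simp
qed

end

section \<open>The canonical map\<close>

lemma lin_ext_bal:
  assumes f: "bilin s sc f" and G: "\<forall>r\<in>G. lin_ext sc (\<lambda>(a, b). f a b) r = 0"
  shows "lin_ext sc (\<lambda>(a, b). f a b) (bal (free.span G) a b) = f a b"
  unfolding bal_def
  by (simp add: lin_nf[OF linear_lin_ext[OF bilinD(1)[OF f]] G] lin_ext_basis[OF bilinD(1)[OF f]])

lemma nf_rep_qlift:
  assumes "free.subspace R"
  shows "nf R (rep (qlift R f X)) = vlift fscale (\<lambda>x. nf R (rep (f x))) X"
  unfolding qlift_eq_qcls[OF assms] nf_rep_qcls[OF assms] vlift_def
  by (simp add: lin_lin_ext[OF nf_props(1)[OF assms]] nf_nf[OF assms])

lemma nf_rep_tens2: "nf (ker2 s) (rep (tens2 s a b)) = bal (ker2 s) a b"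
  by (simp add: tens2_def bal_def nf_rep_qcls[OF subspace_ker2])

section \<open>Simple tensors over the field and over the source counital subalgebra\<close>

context weak_bialgebra
begin

abbreviation K where "K \<equiv> ker_over H_s"
abbreviation t where "t \<equiv> bal (ker2 scale)"
abbreviation tb where "tb \<equiv> bal K"

lemma subspace_K: "free.subspace K"
  by (simp add: ker_over_def)

lemma bilin_t: "bilin scale fscale t"
  by (rule bilin_bal[OF vector_space_scale subspace_ker2]) (simp add: ker2_def free.span_superset)

lemma bilin_tb: "bilin scale fscale tb"
  by (rule bilin_bal[OF vector_space_scale subspace_K])
    (unfold ker_over_def, rule order_trans[OF _ free.span_superset], blast)

lemma tb_balanced:
  assumes "x \<in> H_s"
  shows "tb (g * x) h = tb g (x * h)"
proof -
  have "basis (g * x, h) - basis (g, x * h) \<in> K"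
    unfolding ker_over_def using assms by (intro free.span_base) blast
  then show ?thesis
    by (simp add: bal_def nf_eq_iff[OF subspace_K])
qed

lemmas lin_bal_intros = lin_intros lin_bilin_left[OF bilin_t] lin_bilin_right[OF bilin_t]
  lin_bilin_left[OF bilin_tb] lin_bilin_right[OF bilin_tb]

lemma balanced_relations:
  assumes f: "bilin scale sc f" and "\<And>g x h. x \<in> H_s \<Longrightarrow> f (g * x) h = f g (x * h)"
  shows "\<forall>r\<in>rel2 scale \<union> {basis (g * x, h) - basis (g, x * h) | g x h. x \<in> H_s}.
    lin_ext sc (\<lambda>(a, b). f a b) r = 0"
proof -
  note vs = bilinD(1)[OF f]
  interpret L: Vector_Spaces.linear fscale sc "lin_ext sc (\<lambda>(a, b). f a b)"
    by (rule linear_lin_ext[OF vs])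
  show ?thesis
    using bilin_rel2[OF f] by (auto simp: L.diff lin_ext_basis[OF vs] assms(2))
qed

lemma lin_ext_t:
  assumes "bilin scale sc f"
  shows "lin_ext sc (\<lambda>(a, b). f a b) (t g h) = f g h"
  unfolding ker2_def by (rule lin_ext_bal[OF assms bilin_rel2[OF assms]])

lemma lin_ext_tb:
  assumes "bilin scale sc f" "\<And>g x h. x \<in> H_s \<Longrightarrow> f (g * x) h = f g (x * h)"
  shows "lin_ext sc (\<lambda>(a, b). f a b) (tb g h) = f g h"
  unfolding ker_over_def by (rule lin_ext_bal[OF assms(1) balanced_relations[OF assms]])

lemma lin_ext_nf_K:
  assumes "bilin scale sc f" "\<And>g x h. x \<in> H_s \<Longrightarrow> f (g * x) h = f g (x * h)"
  shows "lin_ext sc (\<lambda>(a, b). f a b) (nf K u) = lin_ext sc (\<lambda>(a, b). f a b) u"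
  unfolding ker_over_def
  by (rule lin_nf[OF linear_lin_ext[OF bilinD(1)[OF assms(1)]] balanced_relations[OF assms]])

text \<open>\<open>can\<close> and \<open>proj\<close> are \<open>\<beta>\<^sub>0\<close> and left multiplication by \<open>\<Delta>(1)\<close>, with values in normal forms.\<close>

definition can_gen :: "'h \<Rightarrow> 'h \<Rightarrow> ('h \<times> 'h \<Rightarrow>\<^sub>0 'k)" where
  "can_gen g h = sw fscale g (\<lambda>a b. t a (b * h))"

definition proj_gen :: "'h \<Rightarrow> 'h \<Rightarrow> ('h \<times> 'h \<Rightarrow>\<^sub>0 'k)" where
  "proj_gen g h = sw fscale 1 (\<lambda>a b. t (a * g) (b * h))"

definition can :: "('h \<times> 'h \<Rightarrow>\<^sub>0 'k) \<Rightarrow> ('h \<times> 'h \<Rightarrow>\<^sub>0 'k)" where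
  "can = lin_ext fscale (\<lambda>(g, h). can_gen g h)"

definition proj :: "('h \<times> 'h \<Rightarrow>\<^sub>0 'k) \<Rightarrow> ('h \<times> 'h \<Rightarrow>\<^sub>0 'k)" where
  "proj = lin_ext fscale (\<lambda>(g, h). proj_gen g h)"

lemma bilin_can_gen: "bilin scale fscale can_gen"
  unfolding can_gen_def by (intro lin_bal_intros lin_sw_arg)

lemma bilin_proj_gen: "bilin scale fscale proj_gen"
  unfolding proj_gen_def by (intro lin_bal_intros)

lemma can_gen_balanced:
  assumes "x \<in> H_s"
  shows "can_gen (g * x) h = can_gen g (x * h)"
proof -
  have b: "bilin scale fscale (\<lambda>a b. t a (b * h))" by (intro lin_bal_intros)
  show ?thesis by (simp add: can_gen_def sw_mult_H_s[OF b assms] mult.assoc)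
qed

lemma lin_can: "lin fscale fscale can"
  unfolding can_def by (rule lin_fscale_lin_ext)

lemma lin_proj: "lin fscale fscale proj"
  unfolding proj_def by (rule lin_fscale_lin_ext)

lemma can_basis: "can (basis (g, h)) = can_gen g h"
  by (simp add: can_def lin_ext_basis[OF vector_space_fscale])

lemma proj_basis: "proj (basis (g, h)) = proj_gen g h"
  by (simp add: proj_def lin_ext_basis[OF vector_space_fscale])

lemma can_tb: "can (tb g h) = can_gen g h"
  unfolding can_def by (rule lin_ext_tb[OF bilin_can_gen], rule can_gen_balanced)

lemma proj_t: "proj (t g h) = proj_gen g h"
  unfolding proj_def by (rule lin_ext_t[OF bilin_proj_gen])

lemma can_nf: "can (nf K u) = can u"
  unfolding can_def by (rule lin_ext_nf_K[OF bilin_can_gen], rule can_gen_balanced)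

lemma nf_t: "nf (ker2 scale) (t a b) = t a b"
  by (simp add: bal_def nf_nf[OF subspace_ker2])

text \<open>The values of \<open>can\<close> are combinations of normal forms \<open>t a b\<close>.
  Equality of cosets thereby becomes equality in the free space.\<close>

lemma nf_can: "nf (ker2 scale) (can u) = can u"
proof (rule lin_eq_on_basis[OF lin_compose[OF lin_can nf_props(1)[OF subspace_ker2]] lin_can])
  fix x :: "'h \<times> 'h"
  show "nf (ker2 scale) (can (basis x)) = can (basis x)"
    by (cases x) (simp add: can_basis can_gen_def sw_lin[OF nf_props(1)[OF subspace_ker2]] nf_t)
qed

lemma nf_proj: "nf (ker2 scale) (proj u) = proj u"
proof (rule lin_eq_on_basis[OF lin_compose[OF lin_proj nf_props(1)[OF subspace_ker2]] lin_proj])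
  fix x :: "'h \<times> 'h"
  show "nf (ker2 scale) (proj (basis x)) = proj (basis x)"
    by (cases x) (simp add: proj_basis proj_gen_def sw_lin[OF nf_props(1)[OF subspace_ker2]] nf_t)
qed

lemma beta0_qcls: "beta0 (qcls (ker2 scale) u) = qcls (ker2 scale) (can u)"
proof -
  have "beta0 (qcls (ker2 scale) u) =
      qcls (ker2 scale) (vlift fscale (\<lambda>(g, h). can_gen g h) (qcls (ker2 scale) u))"
    unfolding beta0_def qlift_eq_qcls[OF subspace_ker2, where X = "qcls (ker2 scale) u"]
    by (simp add: case_prod_unfold nf_rep_qlift[OF subspace_ker2] nf_rep_tens2 can_gen_def sw_def)
  then show ?thesis
    by (simp add: can_def vlift_ker2[OF bilin_can_gen])
qed

lemma mult2_comult_one_qcls: "mult2 (\<Delta> 1) (qcls (ker2 scale) u) = qcls (ker2 scale) (proj u)"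
proof -
  have b: "bilin scale fscale (\<lambda>c d. t (a * c) (b * d))" for a b by (intro lin_bal_intros)
  have "mult2 (\<Delta> 1) (qcls (ker2 scale) u) =
      qcls (ker2 scale) (sw fscale 1 (\<lambda>a b. vlift fscale (\<lambda>(c, d). t (a * c) (b * d)) (qcls (ker2 scale) u)))"
    unfolding mult2_def qlift_eq_qcls[OF subspace_ker2, where X = "\<Delta> 1"] sw_def
    by (simp add: case_prod_unfold nf_rep_qlift[OF subspace_ker2] nf_rep_tens2)
  also have "\<dots> = qcls (ker2 scale) (sw fscale 1 (\<lambda>a b. lin_ext fscale (\<lambda>(c, d). t (a * c) (b * d)) u))"
    by (simp add: vlift_ker2[OF b])
  also have "sw fscale 1 (\<lambda>a b. lin_ext fscale (\<lambda>(c, d). t (a * c) (b * d)) u) = proj u"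
  proof (rule lin_eq_on_basis[OF lin_sw[OF lin_fscale_lin_ext] lin_proj])
    fix x :: "'h \<times> 'h"
    show "sw fscale 1 (\<lambda>a b. lin_ext fscale (\<lambda>(c, d). t (a * c) (b * d)) (basis x)) = proj (basis x)"
      by (cases x) (simp add: lin_ext_basis[OF vector_space_fscale] proj_basis proj_gen_def)
  qed
  finally show ?thesis .
qed

section \<open>The isomorphism condition in terms of linear maps on free spaces\<close>

lemma comult_one_ideal_eq: "comult_one_ideal = range (\<lambda>u. qcls (ker2 scale) (proj u))"
  by (simp add: comult_one_ideal_def quot_def image_image mult2_comult_one_qcls)

lemma qcls_can_eq_iff: "qcls (ker2 scale) (can u) = qcls (ker2 scale) (can v) \<longleftrightarrow> can u = can v"
  and qcls_can_eq_proj_iff: "qcls (ker2 scale) (can u) = qcls (ker2 scale) (proj v) \<longleftrightarrow> can u = proj v"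
  by (simp_all add: qcls_eq_iff_nf[OF subspace_ker2] nf_can nf_proj)

text \<open>The first conjunct in \<open>beta0_induces_iso\<close> forces the value of \<beta> on
  every coset, so what remains is injectivity and the image, both readable from
  \<open>can\<close>.\<close>

lemma beta0_induces_iso_iff:
  "beta0_induces_iso \<longleftrightarrow> (\<forall>u v. can u = can v \<longrightarrow> nf K u = nf K v) \<and> range can = range proj"
proof
  assume beta0_induces_iso
  then obtain \<beta> where iso: "(\<forall>u. \<beta> (qcls K u) = beta0 (qcls (ker2 scale) u)) \<and>
      quot_linear K (ker2 scale) \<beta> \<and> bij_betw \<beta> (quot K) comult_one_ideal"
    unfolding beta0_induces_iso_def by (rule exE)
  then have \<beta>: "\<beta> (qcls K u) = qcls (ker2 scale) (can u)" for u
    by (simp add: beta0_qcls)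
  from iso have bij: "bij_betw \<beta> (quot K) comult_one_ideal" by simp
  have "nf K u = nf K v" if "can u = can v" for u v
  proof -
    have "qcls K u = qcls K v"
      by (rule inj_onD[OF bij_betw_imp_inj_on[OF bij]]) (simp_all add: \<beta> that quot_def)
    then show ?thesis by (simp add: qcls_eq_iff_nf[OF subspace_K])
  qed
  moreover have "range (\<lambda>u. qcls (ker2 scale) (can u)) = range (\<lambda>u. qcls (ker2 scale) (proj u))"
    using bij_betw_imp_surj_on[OF bij] by (simp add: quot_def image_image \<beta> comult_one_ideal_eq)
  then have rng: "qcls (ker2 scale) (can u) \<in> range (\<lambda>v. qcls (ker2 scale) (proj v))"
    "qcls (ker2 scale) (proj u) \<in> range (\<lambda>v. qcls (ker2 scale) (can v))" for u
    by (metis rangeI)+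
  have "range can = range proj"
  proof (intro subset_antisym image_subsetI)
    fix u
    obtain v where "qcls (ker2 scale) (can u) = qcls (ker2 scale) (proj v)" using rng(1)[of u] by (rule rangeE)
    then show "can u \<in> range proj" by (simp add: qcls_can_eq_proj_iff)
    obtain w where "qcls (ker2 scale) (proj u) = qcls (ker2 scale) (can w)" using rng(2)[of u] by (rule rangeE)
    from this[symmetric] have "can w = proj u" by (simp only: qcls_can_eq_proj_iff)
    then show "proj u \<in> range can" by (rule range_eqI[OF sym])
  qed
  ultimately show "(\<forall>u v. can u = can v \<longrightarrow> nf K u = nf K v) \<and> range can = range proj"
    by blast
next
  assume *: "(\<forall>u v. can u = can v \<longrightarrow> nf K u = nf K v) \<and> range can = range proj"
  \<comment> \<open>The choice made by \<open>rep\<close> is harmless, since \<open>can\<close>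
    depends only on \<open>nf K\<close>.\<close>
  define \<beta> where "\<beta> X = qcls (ker2 scale) (can (rep X))" for X
  have \<beta>: "\<beta> (qcls K u) = qcls (ker2 scale) (can u)" for u
    unfolding \<beta>_def by (metis can_nf nf_rep_qcls[OF subspace_K])
  interpret C: Vector_Spaces.linear fscale fscale can by (rule lin_can)
  have "quot_linear K (ker2 scale) \<beta>"
    by (auto simp: quot_linear_def quot_def qadd_qcls subspace_K subspace_ker2 qscale_qcls \<beta> C.add C.scale)
  moreover have "inj_on \<beta> (quot K)"
    unfolding quot_def
  proof (rule inj_onI, elim rangeE)
    fix X Y u v
    assume "\<beta> X = \<beta> Y" and X: "X = qcls K u" and Y: "Y = qcls K v"
    then have "can u = can v" by (simp add: \<beta> qcls_can_eq_iff)
    with * show "X = Y" unfolding X Y qcls_eq_iff_nf[OF subspace_K] by blast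
  qed
  moreover have "\<beta> ` quot K = comult_one_ideal"
  proof -
    have "qcls (ker2 scale) ` range can = qcls (ker2 scale) ` range proj" using * by simp
    then show ?thesis by (simp add: quot_def image_image \<beta> comult_one_ideal_eq)
  qed
  ultimately show beta0_induces_iso
    unfolding beta0_induces_iso_def bij_betw_def
    by (intro exI[of _ \<beta>] conjI allI) (simp_all only: \<beta> beta0_qcls)
qed

text \<open>\<open>\<Delta>(1)\<Delta>(g) = \<Delta>(g)\<close>, so the image of \<beta> lies in
  \<open>\<Delta>(1)(H \<otimes> H)\<close>.\<close>

lemma proj_can: "proj (can u) = can u"
proof (rule lin_eq_on_basis[OF lin_compose[OF lin_can lin_proj] lin_can])
  fix x :: "'h \<times> 'h"
  obtain g h where x: "x = (g, h)" by (cases x)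
  have b: "bilin scale fscale (\<lambda>a z. t a (z * h))" by (intro lin_bal_intros)
  show "proj (can (basis x)) = can (basis x)"
    by (simp add: x can_basis can_gen_def sw_lin[OF lin_proj] proj_t proj_gen_def
        sw_swap[OF vector_space_fscale, of g 1] sw_mult_one[OF b] flip: mult.assoc)
qed

section \<open>From an antipode to the inverse of \<beta>\<close>

lemma iso_if_antipode:
  assumes "is_antipode S"
  shows beta0_induces_iso
proof -
  have S: "lin scale scale S" and S1: "\<And>h. sw scale h (\<lambda>a b. S a * b) = eps_s h"
    and S2: "\<And>h. sw scale h (\<lambda>a b. a * S b) = eps_t h"
    using assms by (auto simp: is_antipode_def sw_def)
  note lins = lin_bal_intros lin_compose[OF _ S]
  define G where "G g h = sw fscale g (\<lambda>a b. tb a (S b * h))" for g h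
  have bG: "bilin scale fscale G"
    unfolding G_def by (intro lins lin_sw_arg)
  let ?G = "lin_ext fscale (\<lambda>(g, h). G g h)"
  have G_can: "?G (can u) = nf K u" for u
  proof (rule lin_eq_on_basis[OF lin_compose[OF lin_can lin_fscale_lin_ext] nf_props(1)[OF subspace_K]])
    fix x :: "'h \<times> 'h"
    obtain g h where x: "x = (g, h)" by (cases x)
    have T: "trilin scale fscale (\<lambda>a c d. tb a (S c * (d * h)))" by (intro lins)
    have L: "lin scale fscale (\<lambda>z. tb a (z * h))" for a by (intro lins)
    have L': "lin scale fscale (\<lambda>z. tb z h)" by (intro lins)
    have "?G (can (basis x)) = sw fscale g (\<lambda>a b. sw fscale a (\<lambda>c d. tb c (S d * (b * h))))"
      by (simp add: x can_basis can_gen_def sw_lin[OF lin_fscale_lin_ext] lin_ext_t[OF bG])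
        (simp add: G_def)
    also have "\<dots> = sw fscale g (\<lambda>a b. tb a (eps_s b * h))"
      by (simp add: sw_coassoc[OF T] sw_lin[OF L] mult.assoc flip: S1)
    \<comment> \<open>Balancing over \<open>H_s\<close> enters here: \<open>eps_s b\<close> moves to
      the left factor, where \<open>g\<^sub>1 \<epsilon>\<^sub>s(g\<^sub>2) = g\<close>
      applies.\<close>
    also have "\<dots> = sw fscale g (\<lambda>a b. tb (a * eps_s b) h)"
      by (simp add: tb_balanced eps_s_in_H_s)
    also have "\<dots> = nf K (basis x)"
      unfolding sw_mult_eps_s[OF L'] by (simp add: x bal_def)
    finally show "?G (can (basis x)) = nf K (basis x)" .
  qed
  have can_G: "can (?G u) = proj u" for u
  proof (rule lin_eq_on_basis[OF lin_compose[OF lin_fscale_lin_ext lin_can] lin_proj])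
    fix x :: "'h \<times> 'h"
    obtain g h where x: "x = (g, h)" by (cases x)
    have T: "trilin scale fscale (\<lambda>a c d. t a (c * (S d * h)))" by (intro lins)
    have L: "lin scale fscale (\<lambda>z. t a (z * h))" for a by (intro lins)
    have b: "bilin scale fscale (\<lambda>a z. t a (z * h))" by (intro lins)
    have "can (?G (basis x)) = sw fscale g (\<lambda>a b. sw fscale a (\<lambda>c d. t c (d * (S b * h))))"
      by (simp add: x lin_ext_basis[OF vector_space_fscale] G_def sw_lin[OF lin_can] can_tb can_gen_def)
    \<comment> \<open>Coassociativity brings \<open>g\<^sub>2 S(g\<^sub>3)\<close> together in the
      second factor.\<close>
    also have "\<dots> = sw fscale g (\<lambda>a b. t a (eps_t b * h))"
      by (simp add: sw_coassoc[OF T] sw_lin[OF L] mult.assoc flip: S2)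
    also have "\<dots> = proj (basis x)"
      by (simp add: sw_eps_t[OF b] x proj_basis proj_gen_def)
    finally show "can (?G (basis x)) = proj (basis x)" .
  qed
  show ?thesis
    unfolding beta0_induces_iso_iff
  proof (intro conjI allI impI)
    show "nf K u = nf K v" if "can u = can v" for u v
      using G_can that by metis
    show "range can = range proj"
    proof (intro subset_antisym image_subsetI)
      show "can u \<in> range proj" for u
        by (rule range_eqI[where f = proj and x = "can u", OF proj_can[symmetric]])
      show "proj u \<in> range can" for u
        by (rule range_eqI[where f = can and x = "?G u", OF can_G[symmetric]])
    qed
  qed
qed

section \<open>From the inverse of \<beta> to an antipode\<close>

lemma antipode_if_iso:
  assumes beta0_induces_iso
  shows "\<exists>S. is_antipode S"
proof -
  have inj: "nf K u = nf K v" if "can u = can v" for u v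
    using assms that unfolding beta0_induces_iso_iff by blast
  have rng: "range can = range proj"
    using assms unfolding beta0_induces_iso_iff by blast
  interpret P: vector_space_pair "fscale :: 'k \<Rightarrow> ('h \<times> 'h \<Rightarrow>\<^sub>0 'k) \<Rightarrow> _" "fscale :: 'k \<Rightarrow> ('h \<times> 'h \<Rightarrow>\<^sub>0 'k) \<Rightarrow> _"
    by unfold_locales
  \<comment> \<open>A linear section of \<open>can\<close> over its image. It picks representatives
    in the free space, so \<open>\<gamma>\<close> represents the inverse of \<beta> only modulo
    \<open>K\<close>.\<close>
  obtain r where r: "lin fscale fscale r" "\<And>v. v \<in> range can \<Longrightarrow> can (r v) = v"
    using P.linear_exists_right_inverse_on[OF lin_can free.subspace_UNIV] by blast
  define \<gamma> where "\<gamma> u = r (proj u)" for u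
  have lin_\<gamma>: "lin fscale fscale \<gamma>"
    unfolding \<gamma>_def by (rule lin_compose[OF lin_proj r(1)])
  have can_\<gamma>: "can (\<gamma> u) = proj u" for u
    unfolding \<gamma>_def by (rule r(2)) (simp add: rng)
  have proj_proj: "proj (proj u) = proj u" for u
    by (metis proj_can can_\<gamma>)
  define M where "M = lin_ext scale (\<lambda>(g, h). eps_s g * h)"
  have bM: "bilin scale scale (\<lambda>g h. eps_s g * h)"
    by (intro lin_intros lin_eps_s)
  have balM: "eps_s (g * x) * h = eps_s g * (x * h)" if "x \<in> H_s" for g x h
    by (simp add: eps_s_mult_H_s[OF that] mult.assoc)
  have lin_M: "lin fscale scale M"
    unfolding M_def by (rule linear_lin_ext[OF vector_space_scale])
  have M_basis: "M (basis (g, h)) = eps_s g * h" for g h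
    by (simp add: M_def lin_ext_basis[OF vector_space_scale])
  have M_tb: "M (tb g h) = eps_s g * h" for g h
    unfolding M_def by (rule lin_ext_tb[OF bM], rule balM)
  have M_nf: "M (nf K u) = M u" for u
    unfolding M_def by (rule lin_ext_nf_K[OF bM], rule balM)
  \<comment> \<open>\<open>M\<close> factors through the quotient by \<open>K\<close>, on which
    \<beta> is injective. Equalities between values of \<open>M\<close> can therefore be checked
    after applying \<open>can\<close>.\<close>
  have M_eq: "M u = M v" if "can u = can v" for u v
    using inj[OF that] M_nf by metis
  have lin_M\<gamma>: "lin fscale scale (\<lambda>u. M (\<gamma> u))"
    by (rule lin_compose[OF lin_\<gamma> lin_M])
  define S where "S g = M (\<gamma> (t g 1))" for g
  have S: "lin scale scale S"
    unfolding S_def by (intro lin_compose[OF _ lin_M\<gamma>] lin_bal_intros)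
  note lins = lin_bal_intros lin_compose[OF _ S]
  \<comment> \<open>Right \<open>H\<close>-linearity: \<open>R\<close> and \<open>R'\<close>
    multiply the second factor by \<open>x\<close> over \<open>H_s\<close> and over the field.
    \<open>can\<close> intertwines them, and left multiplication by \<open>\<Delta>(1)\<close>
    commutes with \<open>R'\<close>.\<close>
  have M\<gamma>_t: "M (\<gamma> (t g x)) = S g * x" for g x
  proof -
    define R where "R = lin_ext fscale (\<lambda>(g, h). tb g (h * x))"
    define R' where "R' = lin_ext fscale (\<lambda>(g, h). t g (h * x))"
    have lin_R: "lin fscale fscale R" and lin_R': "lin fscale fscale R'"
      unfolding R_def R'_def by (rule lin_fscale_lin_ext)+
    have bR': "bilin scale fscale (\<lambda>g h. t g (h * x))" by (intro lins)
    have R'_t: "R' (t g h) = t g (h * x)" for g h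
      unfolding R'_def by (rule lin_ext_t[OF bR'])
    have R_basis: "R (basis (g, h)) = tb g (h * x)" for g h
      by (simp add: R_def lin_ext_basis[OF vector_space_fscale])
    have can_R: "can (R u) = R' (can u)" for u
    proof (rule lin_eq_on_basis[OF lin_compose[OF lin_R lin_can] lin_compose[OF lin_can lin_R']])
      fix z :: "'h \<times> 'h"
      show "can (R (basis z)) = R' (can (basis z))"
        by (cases z) (simp add: R_basis can_tb can_basis can_gen_def sw_lin[OF lin_R'] R'_t mult.assoc)
    qed
    have M_R: "M (R u) = M u * x" for u
    proof (rule lin_eq_on_basis[OF lin_compose[OF lin_R lin_M] lin_mult_left[OF lin_M]])
      fix z :: "'h \<times> 'h"
      show "M (R (basis z)) = M (basis z) * x"
        by (cases z) (simp add: R_basis M_tb M_basis mult.assoc)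
    qed
    have "can (\<gamma> (t g x)) = can (R (\<gamma> (t g 1)))"
      by (simp add: can_R can_\<gamma> proj_t proj_gen_def sw_lin[OF lin_R'] R'_t)
    then have "M (\<gamma> (t g x)) = M (R (\<gamma> (t g 1)))"
      by (rule M_eq)
    then show ?thesis
      by (simp add: M_R S_def)
  qed
  \<comment> \<open>\<open>proj\<close> fixes the image of \<open>can\<close>, so
    \<open>\<gamma>\<close> after \<open>can\<close> is the identity as far as \<open>M\<close> can
    see.\<close>
  have S_can: "sw scale g (\<lambda>a b. S a * (b * h)) = eps_s g * h" for g h
  proof -
    have "sw scale g (\<lambda>a b. S a * (b * h)) = M (\<gamma> (can (basis (g, h))))"
      by (simp add: can_basis can_gen_def sw_lin[OF lin_M\<gamma>] M\<gamma>_t)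
    also have "\<dots> = M (basis (g, h))"
      by (rule M_eq) (simp add: can_\<gamma> proj_can)
    finally show ?thesis by (simp add: M_basis)
  qed
  \<comment> \<open>Idempotence of \<open>proj\<close> makes \<open>M\<close> after
    \<open>\<gamma>\<close> blind to an extra factor \<open>\<Delta>(1)\<close>.\<close>
  have S_proj: "sw scale 1 (\<lambda>a b. S (a * g) * b) = S g" for g
  proof -
    have "sw scale 1 (\<lambda>a b. S (a * g) * b) = M (\<gamma> (proj (t g 1)))"
      by (simp add: proj_t proj_gen_def sw_lin[OF lin_M\<gamma>] M\<gamma>_t)
    also have "\<dots> = M (\<gamma> (t g 1))"
      by (rule M_eq) (simp add: can_\<gamma> proj_proj)
    finally show ?thesis by (simp add: S_def)
  qed
  have S1: "sw scale h (\<lambda>a b. S a * b) = eps_s h" for h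
    using S_can[of h 1] by simp
  have S2: "sw scale h (\<lambda>a b. a * S b) = eps_t h" for h
  proof -
    define q where "q g z = sw scale g (\<lambda>a b. a * S b * z)" for g z
    define Q where "Q = lin_ext scale (\<lambda>(g, z). q g z)"
    define E where "E = lin_ext scale (\<lambda>(a, b). scale (\<epsilon> a) b)"
    have bq: "bilin scale scale q" unfolding q_def by (intro lins lin_sw_arg)
    have bE: "bilin scale scale (\<lambda>a b. scale (\<epsilon> a) b)" by (intro lins)
    have lin_Q: "lin fscale scale Q" and lin_E: "lin fscale scale E"
      unfolding Q_def E_def by (rule linear_lin_ext[OF vector_space_scale])+
    have Q_t: "Q (t g z) = q g z" and E_t: "E (t g z) = scale (\<epsilon> g) z" for g z
      unfolding Q_def E_def by (rule lin_ext_t[OF bq], rule lin_ext_t[OF bE])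
    have Q_can: "Q (can u) = E (can u)" for u
    proof (rule lin_eq_on_basis[OF lin_compose[OF lin_can lin_Q] lin_compose[OF lin_can lin_E]])
      fix x :: "'h \<times> 'h"
      obtain g z where x: "x = (g, z)" by (cases x)
      have T: "trilin scale scale (\<lambda>a c d. a * S c * (d * z))" by (intro lins)
      have L: "lin scale scale (\<lambda>y. y * z)" and L': "lin scale scale (\<lambda>y. a * y)" for a by (intro lins)+
      have "Q (can (basis x)) = sw scale g (\<lambda>a b. sw scale a (\<lambda>c d. c * S d * (b * z)))"
        by (simp add: x can_basis can_gen_def sw_lin[OF lin_Q] Q_t q_def)
      \<comment> \<open>Regrouping \<open>g\<^sub>1 S(g\<^sub>2) g\<^sub>3 z\<close> exposes
        \<open>g\<^sub>1 \<epsilon>\<^sub>s(g\<^sub>2) z\<close>, which is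
        \<open>g * z\<close>.\<close>
      also have "\<dots> = sw scale g (\<lambda>a b. a * sw scale b (\<lambda>c d. S c * (d * z)))"
        unfolding sw_coassoc[OF T] by (simp add: sw_lin[OF L'] mult.assoc)
      also have "\<dots> = g * z"
        using sw_mult_eps_s[OF L, of g] by (simp add: S_can mult.assoc)
      also have "\<dots> = sw scale g (\<lambda>a b. scale (\<epsilon> a) (b * z))"
        by (rule sw_counit_left[OF L, symmetric])
      also have "\<dots> = E (can (basis x))"
        by (simp add: x can_basis can_gen_def sw_lin[OF lin_E] E_t)
      finally show "Q (can (basis x)) = E (can (basis x))" .
    qed
    have b1: "bilin scale scale (\<lambda>c d. c * S d * z)" for z by (intro lins)
    have b2: "bilin scale scale (\<lambda>a b. a * S b)" by (intro lins)
    have T: "trilin scale scale (\<lambda>p q z. sw scale h (\<lambda>r s. p * r * S (q * s) * z))" by (intro lins)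
    have L: "lin scale scale (\<lambda>y. a * y)" for a by (intro lins)
    have "eps_t h = E (proj (t h 1))"
      by (simp add: proj_t proj_gen_def sw_lin[OF lin_E] E_t eps_t_sw)
    \<comment> \<open>\<open>proj (t h 1)\<close> equals \<open>can (\<gamma> (t h 1))\<close>, so
      \<open>Q\<close> and \<open>E\<close> agree there.\<close>
    also have "\<dots> = Q (proj (t h 1))"
      by (simp add: Q_can flip: can_\<gamma>)
    also have "\<dots> = sw scale 1 (\<lambda>a b. sw scale a (\<lambda>p q. sw scale h (\<lambda>r s. p * r * S (q * s) * b)))"
      by (simp add: proj_t proj_gen_def sw_lin[OF lin_Q] Q_t q_def sw_mult[OF b1])
    \<comment> \<open>The second formula for \<open>comult2 1\<close> separates two copies of
      \<open>\<Delta>(1)\<close>: \<open>S_proj\<close> removes the one in \<open>c\<close>,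
      \<open>d\<close>, and \<open>\<Delta>(h)\<close> absorbs the other.\<close>
    also have "\<dots> = sw scale 1 (\<lambda>a b. sw scale 1 (\<lambda>c d. sw scale h (\<lambda>r s. a * r * S (c * b * s) * d)))"
      by (rule sw_comult_one(2)[OF T])
    also have "\<dots> = sw scale 1 (\<lambda>a b. sw scale h (\<lambda>r s. a * r * sw scale 1 (\<lambda>c d. S (c * (b * s)) * d)))"
      by (simp add: sw_swap[OF vector_space_scale, of 1 h] sw_lin[OF L] mult.assoc)
    also have "\<dots> = sw scale h (\<lambda>a b. a * S b)"
      by (simp add: S_proj sw_mult_one[OF b2])
    finally show ?thesis by simp
  qed
  \<comment> \<open>The last two factors form \<open>\<epsilon>\<^sub>t(h\<^sub>2)\<close>;
    \<open>sw_eps_t\<close> then leaves \<open>S(1\<^sub>1 h) 1\<^sub>2\<close>, which is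
    \<open>S h\<close> by \<open>S_proj\<close>.\<close>
  have "vlift scale (\<lambda>(a, b, d). S a * b * S d) (comult2 h) = S h" for h
  proof -
    have T: "trilin scale scale (\<lambda>a b d. S a * b * S d)" by (intro lins)
    have L: "lin scale scale (\<lambda>y. a * y)" for a by (intro lins)
    have b: "bilin scale scale (\<lambda>a b. S a * b)" by (intro lins)
    have "vlift scale (\<lambda>(a, b, d). S a * b * S d) (comult2 h) = sw scale h (\<lambda>a b. S a * sw scale b (\<lambda>p q. p * S q))"
      unfolding vlift_comult2[OF T] sw_coassoc[OF T] by (simp add: sw_lin[OF L] mult.assoc)
    also have "\<dots> = S h"
      by (simp add: S2 sw_eps_t[OF b] S_proj)
    finally show ?thesis .
  qed
  with S S1 S2 have "is_antipode S"
    by (simp add: is_antipode_def sw_def)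
  then show ?thesis by blast
qed

end

theorem theorem6p1:
  fixes scale :: "'k::field \<Rightarrow> 'h::{ring, monoid_mult} \<Rightarrow> 'h"
    and \<Delta> :: "'h \<Rightarrow> ('h \<times> 'h \<Rightarrow>\<^sub>0 'k) set"
    and \<epsilon> :: "'h \<Rightarrow> 'k"
  assumes "weak_bialgebra scale \<Delta> \<epsilon>"
  shows "weak_hopf_algebra scale \<Delta> \<epsilon> \<longleftrightarrow> weak_bialgebra.beta0_induces_iso scale \<Delta> \<epsilon>"
proof -
  interpret weak_bialgebra scale \<Delta> \<epsilon> by fact
  have "weak_hopf_algebra scale \<Delta> \<epsilon> \<longleftrightarrow> (\<exists>S. is_antipode S)"
    using assms by (simp add: weak_hopf_algebra_def weak_hopf_algebra_axioms_def)
  then show ?thesis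
    using iso_if_antipode antipode_if_iso by blast
qed

end
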